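(* Let $\chi$ and $\omega$ be two Hermitian metrics on a compact complex manifold, with $\chi=i\chi_{\bar kj}\,dz^j\wedge d\bar z^k$ and $\omega=i g_{\bar kj}\,dz^j\wedge d\bar z^k$ in local holomorphic coordinates, and let $h^p{}_q=\chi^{p\bar r}g_{\bar rq}$. If $\partial\omega=\partial\chi$ (in particular if $\omega-\chi$ is $i\partial\bar\partial$-exact), then, at every point, $$\begin{aligned} &\frac{g^{j\bar k}\,\partial_j\operatorname{Tr}h\,\partial_{\bar k}\operatorname{Tr}h}{\operatorname{Tr}h}-\chi^{p\bar q}g^{j\bar k}g^{r\bar s}\,\nabla_pg_{\bar sj}\nabla_{\bar q}g_{\bar kr}-\operatorname{Re}\,\chi^{p\bar q}g^{j\bar k}\,\nabla_pg_{\bar sj}\,\overline{T^s_{qk}}-\operatorname{Re}\,\chi^{p\bar q}g^{j\bar k}\,\nabla_{\bar k}g_{\bar qr}\,T^r_{pj}\\ &\le -2\operatorname{Re}\,g^{j\bar k}\frac{\partial_j\operatorname{Tr}h}{\operatorname{Tr}h}\overline{T_k}-\frac{1}{\operatorname{Tr}h}g^{j\bar k}T_j\overline{T_k}+\chi^{p\bar q}g^{j\bar k}\chi_{\bar sr}T^r_{pj}\overline{T^s_{qk}}, \end{aligned}$$ where $T$ is the torsion of the Chern connection $\nabla$ of $\chi$ and $T_j=T^p_{pj}$.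
   Context: Repeated indices are summed. $\chi^{j\bar k}$ and $g^{j\bar k}$ denote the inverse matrices: $\chi^{j\bar k}\chi_{\bar k\ell}=\delta^j{}_\ell$, $g^{j\bar k}g_{\bar k\ell}=\delta^j{}_\ell$. $h$ is an endomorphism of $T^{1,0}X$ and $\operatorname{Tr}$ is the trace of endomorphisms. $\nabla$ is the Chern connection of $\chi$: on sections $V$ of $T^{1,0}X$, $\nabla_jV^p=\partial_jV^p+\Gamma^p_{jq}V^q$ and $\nabla_{\bar k}V^p=\partial_{\bar k}V^p$, where $\Gamma^p_{jq}=\chi^{p\bar r}\partial_j\chi_{\bar rq}$, extended in the usual way to all tensors. Its torsion is $T^p_{jq}=\Gamma^p_{jq}-\Gamma^p_{qj}$ and its torsion 1-form is $T_j=T^p_{pj}$. Each "$\operatorname{Re}$" applies to the whole contracted product that follows it. *)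

theory Defs
  imports "HOL-Analysis.Analysis"
begin

section \<open>Calculus in local holomorphic coordinates\<close>

primrec C_k_on ::
    "nat \<Rightarrow> 'a::real_normed_vector set \<Rightarrow> ('a \<Rightarrow> 'b::real_normed_vector) \<Rightarrow> bool" where
  "C_k_on 0 S f \<longleftrightarrow> continuous_on S f"
| "C_k_on (Suc k) S f \<longleftrightarrow>
     (\<forall>x\<in>S. f differentiable (at x)) \<and>
     (\<forall>v. C_k_on k S (\<lambda>x. frechet_derivative f (at x) v))"

definition smooth_on ::
    "'a::real_normed_vector set \<Rightarrow> ('a \<Rightarrow> 'b::real_normed_vector) \<Rightarrow> bool" where
  "smooth_on S f \<longleftrightarrow> (\<forall>k. C_k_on k S f)"

definition holomorphic_map_on ::
    "(complex^'n::finite) set \<Rightarrow> (complex^'n \<Rightarrow> complex^'m::finite) \<Rightarrow> bool" where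
  "holomorphic_map_on S F \<longleftrightarrow>
     (\<forall>z\<in>S. \<exists>D. (F has_derivative D) (at z) \<and> (\<forall>c v. D (c *s v) = c *s D v))"

text \<open>The Wirtinger derivatives \<open>\<partial>/\<partial>z\<^sup>j\<close> and \<open>\<partial>/\<partial>(cnj z\<^sup>j)\<close>; here \<open>axis j 1\<close> and
  \<open>axis j \<i>\<close> are the real coordinate directions belonging to \<open>z\<^sup>j\<close>.\<close>

definition dz :: "'n::finite \<Rightarrow> (complex^'n \<Rightarrow> complex) \<Rightarrow> complex^'n \<Rightarrow> complex" where
  "dz j f z = (frechet_derivative f (at z) (axis j 1)
               - \<i> * frechet_derivative f (at z) (axis j \<i>)) / 2"

definition dzbar :: "'n::finite \<Rightarrow> (complex^'n \<Rightarrow> complex) \<Rightarrow> complex^'n \<Rightarrow> complex" where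
  "dzbar j f z = (frechet_derivative f (at z) (axis j 1)
                  + \<i> * frechet_derivative f (at z) (axis j \<i>)) / 2"

section \<open>Complex manifolds and Hermitian metrics\<close>

text \<open>A chart is an open set together with its coordinate map, which is only meaningful on
  that set. The atlas need not be maximal.\<close>

type_synonym ('a, 'n) chart = "'a set \<times> ('a \<Rightarrow> complex^'n)"

definition complex_manifold :: "'a topology \<Rightarrow> ('a, 'n::finite) chart set \<Rightarrow> bool" where
  "complex_manifold X A \<longleftrightarrow>
     Hausdorff_space X \<and> second_countable X \<and>
     (\<Union>(U, \<phi>)\<in>A. U) = topspace X \<and>
     (\<forall>(U, \<phi>)\<in>A. openin X U \<and> open (\<phi> ` U) \<and>
        homeomorphic_map (subtopology X U) (top_of_set (\<phi> ` U)) \<phi>) \<and>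
     (\<forall>(U, \<phi>)\<in>A. \<forall>(V, \<psi>)\<in>A.
        holomorphic_map_on (\<phi> ` (U \<inter> V)) (\<psi> \<circ> inv_into U \<phi>))"

text \<open>A matrix \<open>B\<close> with entries \<open>B $ k $ j\<close> stands for the components \<open>B\<^bsub>k-bar j\<^esub>\<close> (the first
  index is the barred one), that is, for the sesquilinear form with the values
  \<open>B(V, W-bar) = B\<^bsub>k-bar j\<^esub> V\<^sup>j cnj (W\<^sup>k)\<close> on vectors of type (1,0).\<close>

definition sesq :: "complex^'n^'n \<Rightarrow> complex^'n \<Rightarrow> complex^'n \<Rightarrow> complex" where
  "sesq B V W = (\<Sum>k\<in>UNIV. \<Sum>j\<in>UNIV. B $ k $ j * V $ j * cnj (W $ k))"

definition pos_def_hermitian :: "complex^'n^'n \<Rightarrow> bool" where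
  "pos_def_hermitian B \<longleftrightarrow>
     (\<forall>k j. B $ k $ j = cnj (B $ j $ k)) \<and> (\<forall>V. V \<noteq> 0 \<longrightarrow> 0 < Re (sesq B V V))"

text \<open>A field of such forms assigns to every chart its component matrices, as functions of the
  coordinates; on overlaps they transform as the coefficients of
  \<open>\<i> g\<^bsub>k-bar j\<^esub> dz\<^sup>j \<and> cnj dz\<^sup>k\<close>.\<close>

type_synonym ('a, 'n) form11 = "('a, 'n) chart \<Rightarrow> complex^'n \<Rightarrow> complex^'n^'n"

definition hermitian_metric :: "('a, 'n::finite) chart set \<Rightarrow> ('a, 'n) form11 \<Rightarrow> bool" where
  "hermitian_metric A \<omega> \<longleftrightarrow>
     (\<forall>(U, \<phi>)\<in>A. smooth_on (\<phi> ` U) (\<omega> (U, \<phi>)) \<and>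
        (\<forall>z\<in>\<phi> ` U. pos_def_hermitian (\<omega> (U, \<phi>) z))) \<and>
     (\<forall>(U, \<phi>)\<in>A. \<forall>(V, \<psi>)\<in>A. \<forall>x\<in>U \<inter> V. \<forall>k j.
        let F = \<psi> \<circ> inv_into U \<phi> in
        \<omega> (U, \<phi>) (\<phi> x) $ k $ j =
          (\<Sum>l\<in>UNIV. \<Sum>m\<in>UNIV. \<omega> (V, \<psi>) (\<psi> x) $ l $ m *
             dz j (\<lambda>w. F w $ m) (\<phi> x) * cnj (dz k (\<lambda>w. F w $ l) (\<phi> x))))"

text \<open>For \<open>\<omega> = \<i> g\<^bsub>k-bar j\<^esub> dz\<^sup>j \<and> cnj dz\<^sup>k\<close> one has
  \<open>\<partial>\<omega> = \<i> \<partial>\<^sub>l g\<^bsub>k-bar j\<^esub> dz\<^sup>l \<and> dz\<^sup>j \<and> cnj dz\<^sup>k\<close>, summed over all \<open>l\<close>, \<open>j\<close>, \<open>k\<close>.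
  As \<open>dz\<^sup>l \<and> dz\<^sup>j\<close> is antisymmetric, the coefficient of the form \<open>dz\<^sup>l \<and> dz\<^sup>j \<and> cnj dz\<^sup>k\<close>
  (with \<open>l \<noteq> j\<close>) is the following.\<close>

definition del_coeff ::
    "(complex^'n::finite \<Rightarrow> complex^'n^'n) \<Rightarrow> complex^'n \<Rightarrow> 'n \<Rightarrow> 'n \<Rightarrow> 'n \<Rightarrow> complex" where
  "del_coeff g z l j k = \<i> * (dz l (\<lambda>w. g w $ k $ j) z - dz j (\<lambda>w. g w $ k $ l) z)"

definition same_del ::
    "('a, 'n::finite) chart set \<Rightarrow> ('a, 'n) form11 \<Rightarrow> ('a, 'n) form11 \<Rightarrow> bool" where
  "same_del A \<omega> \<omega>' \<longleftrightarrow>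
     (\<forall>(U, \<phi>)\<in>A. \<forall>z\<in>\<phi> ` U. \<forall>l j k.
        del_coeff (\<omega> (U, \<phi>)) z l j k = del_coeff (\<omega>' (U, \<phi>)) z l j k)"

text \<open>\<open>\<omega> - \<omega>' = \<i>\<partial>\<partial>-bar u\<close> for a global smooth real function \<open>u\<close>.\<close>

definition diff_ddbar_exact ::
    "('a, 'n::finite) chart set \<Rightarrow> ('a, 'n) form11 \<Rightarrow> ('a, 'n) form11 \<Rightarrow> bool" where
  "diff_ddbar_exact A \<omega> \<omega>' \<longleftrightarrow>
     (\<exists>u :: 'a \<Rightarrow> real. \<forall>(U, \<phi>)\<in>A.
        smooth_on (\<phi> ` U) (u \<circ> inv_into U \<phi>) \<and>
        (\<forall>z\<in>\<phi> ` U. \<forall>k j.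
           \<omega> (U, \<phi>) z $ k $ j - \<omega>' (U, \<phi>) z $ k $ j =
             dz j (dzbar k (\<lambda>w. complex_of_real (u (inv_into U \<phi> w)))) z))"

section \<open>The Chern connection\<close>

text \<open>The entry \<open>matrix_inv B $ j $ k\<close> is \<open>B\<^bsup>j k-bar\<^esup>\<close>. All definitions below are in one
  chart, with \<open>c\<close> the components of the metric whose Chern connection is taken.\<close>

definition endo_h ::
    "(complex^'n::finite \<Rightarrow> complex^'n^'n) \<Rightarrow> (complex^'n \<Rightarrow> complex^'n^'n) \<Rightarrow>
     complex^'n \<Rightarrow> complex^'n^'n" where
  "endo_h c g z = matrix_inv (c z) ** g z"

definition chern_Gamma ::
    "(complex^'n::finite \<Rightarrow> complex^'n^'n) \<Rightarrow> complex^'n \<Rightarrow> 'n \<Rightarrow> 'n \<Rightarrow> 'n \<Rightarrow> complex" where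
  "chern_Gamma c z p j q =
     (\<Sum>r\<in>UNIV. matrix_inv (c z) $ p $ r * dz j (\<lambda>w. c w $ r $ q) z)"

definition torsion ::
    "(complex^'n::finite \<Rightarrow> complex^'n^'n) \<Rightarrow> complex^'n \<Rightarrow> 'n \<Rightarrow> 'n \<Rightarrow> 'n \<Rightarrow> complex" where
  "torsion c z p j q = chern_Gamma c z p j q - chern_Gamma c z p q j"

definition torsion_1form ::
    "(complex^'n::finite \<Rightarrow> complex^'n^'n) \<Rightarrow> complex^'n \<Rightarrow> 'n \<Rightarrow> complex" where
  "torsion_1form c z j = (\<Sum>p\<in>UNIV. torsion c z p p j)"

definition nabla_vec ::
    "(complex^'n::finite \<Rightarrow> complex^'n^'n) \<Rightarrow> 'n \<Rightarrow> (complex^'n \<Rightarrow> complex^'n) \<Rightarrow>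
     complex^'n \<Rightarrow> complex^'n" where
  "nabla_vec c j V z =
     vec_lambda (\<lambda>p. dz j (\<lambda>w. V w $ p) z + (\<Sum>q\<in>UNIV. chern_Gamma c z p j q * V z $ q))"

definition nablabar_vec ::
    "'n::finite \<Rightarrow> (complex^'n \<Rightarrow> complex^'n) \<Rightarrow> complex^'n \<Rightarrow> complex^'n" where
  "nablabar_vec k V z = vec_lambda (\<lambda>p. dzbar k (\<lambda>w. V w $ p) z)"

text \<open>The extension to sesquilinear forms is by conjugation on conjugate vectors and the Leibniz
  rule, applied to the coordinate frame:
  \<open>(\<nabla>\<^sub>p B)(V, W-bar) = \<partial>\<^sub>p (B(V, W-bar)) - B(\<nabla>\<^sub>p V, W-bar) - B(V, cnj (\<nabla>\<^bsub>p-bar\<^esub> W))\<close>,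
  and the same with \<open>p\<close> and \<open>p-bar\<close> exchanged. So \<open>nabla_sesq c B z p s j\<close> is
  \<open>\<nabla>\<^sub>p B\<^bsub>s-bar j\<^esub>\<close> and \<open>nablabar_sesq c B z q k r\<close> is \<open>\<nabla>\<^bsub>q-bar\<^esub> B\<^bsub>k-bar r\<^esub>\<close>.\<close>

definition nabla_sesq ::
    "(complex^'n::finite \<Rightarrow> complex^'n^'n) \<Rightarrow> (complex^'n \<Rightarrow> complex^'n^'n) \<Rightarrow>
     complex^'n \<Rightarrow> 'n \<Rightarrow> 'n \<Rightarrow> 'n \<Rightarrow> complex" where
  "nabla_sesq c B z p s j =
     dz p (\<lambda>w. sesq (B w) (axis j 1) (axis s 1)) z
     - sesq (B z) (nabla_vec c p (\<lambda>_. axis j 1) z) (axis s 1)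
     - sesq (B z) (axis j 1) (nablabar_vec p (\<lambda>_. axis s 1) z)"

definition nablabar_sesq ::
    "(complex^'n::finite \<Rightarrow> complex^'n^'n) \<Rightarrow> (complex^'n \<Rightarrow> complex^'n^'n) \<Rightarrow>
     complex^'n \<Rightarrow> 'n \<Rightarrow> 'n \<Rightarrow> 'n \<Rightarrow> complex" where
  "nablabar_sesq c B z q k r =
     dzbar q (\<lambda>w. sesq (B w) (axis r 1) (axis k 1)) z
     - sesq (B z) (nablabar_vec q (\<lambda>_. axis r 1) z) (axis k 1)
     - sesq (B z) (axis r 1) (nabla_vec c q (\<lambda>_. axis k 1) z)"

lemma sesq_axis_right: "sesq B V (axis s 1) = (\<Sum>j\<in>UNIV. B $ s $ j * V $ j)"
proof -
  have "sesq B V (axis s 1) =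
      (\<Sum>k\<in>UNIV. if k = s then (\<Sum>j\<in>UNIV. B $ k $ j * V $ j) else 0)"
    unfolding sesq_def by (rule sum.cong) (auto simp: axis_def)
  then show ?thesis by simp
qed

lemma sesq_axis_left: "sesq B (axis j 1) W = (\<Sum>k\<in>UNIV. B $ k $ j * cnj (W $ k))"
proof -
  have "(\<Sum>i\<in>UNIV. B $ k $ i * axis j 1 $ i * cnj (W $ k)) = B $ k $ j * cnj (W $ k)" for k
  proof -
    have "(\<Sum>i\<in>UNIV. B $ k $ i * axis j 1 $ i * cnj (W $ k)) =
        (\<Sum>i\<in>UNIV. if i = j then B $ k $ i * cnj (W $ k) else 0)"
      by (rule sum.cong) (auto simp: axis_def)
    then show ?thesis by simp
  qed
  then show ?thesis unfolding sesq_def by simp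
qed

lemma sesq_axis: "sesq B (axis j 1) (axis s 1) = B $ s $ j"
proof -
  have "sesq B (axis j 1) (axis s 1) = (\<Sum>i\<in>UNIV. if i = j then B $ s $ i else 0)"
    unfolding sesq_axis_right by (rule sum.cong) (auto simp: axis_def)
  then show ?thesis by simp
qed

lemma nabla_vec_axis: "nabla_vec c p (\<lambda>_. axis j 1) z $ q = chern_Gamma c z q p j"
proof -
  have "(\<Sum>i\<in>UNIV. chern_Gamma c z q p i * axis j 1 $ i) =
      (\<Sum>i\<in>UNIV. if i = j then chern_Gamma c z q p i else 0)"
    by (rule sum.cong) (auto simp: axis_def)
  then show ?thesis by (simp add: nabla_vec_def dz_def)
qed

lemma nablabar_vec_axis: "nablabar_vec p (\<lambda>_. axis j 1) z = 0"
  by (simp add: nablabar_vec_def dzbar_def vec_eq_iff)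

lemma nabla_sesq_eq:
  "nabla_sesq c B z p s j =
     dz p (\<lambda>w. B w $ s $ j) z - (\<Sum>q\<in>UNIV. chern_Gamma c z q p j * B z $ s $ q)"
proof -
  have "sesq (B z) (axis j 1) (nablabar_vec p (\<lambda>_. axis s 1) z) = 0"
    by (simp add: nablabar_vec_axis sesq_def)
  moreover have "sesq (B z) (nabla_vec c p (\<lambda>_. axis j 1) z) (axis s 1) =
      (\<Sum>q\<in>UNIV. chern_Gamma c z q p j * B z $ s $ q)"
    unfolding sesq_axis_right nabla_vec_axis by (simp add: mult.commute)
  ultimately show ?thesis
    unfolding nabla_sesq_def sesq_axis by simp
qed

lemma nablabar_sesq_eq:
  "nablabar_sesq c B z q k r =
     dzbar q (\<lambda>w. B w $ k $ r) z - (\<Sum>m\<in>UNIV. cnj (chern_Gamma c z m q k) * B z $ m $ r)"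
proof -
  have "sesq (B z) (nablabar_vec q (\<lambda>_. axis r 1) z) (axis k 1) = 0"
    by (simp add: nablabar_vec_axis sesq_def)
  moreover have "sesq (B z) (axis r 1) (nabla_vec c q (\<lambda>_. axis k 1) z) =
      (\<Sum>m\<in>UNIV. cnj (chern_Gamma c z m q k) * B z $ m $ r)"
    unfolding sesq_axis_left nabla_vec_axis by (simp add: mult.commute)
  ultimately show ?thesis
    unfolding nablabar_sesq_def sesq_axis by simp
qed

end

theory Submission
  imports Defs
begin

text \<open>Since \<open>\<nabla>\<chi> = 0\<close>, the equality \<open>\<partial>\<omega> = \<partial>\<chi>\<close> expresses the antisymmetric part of \<open>\<nabla>g\<close> by the
  torsion:
  \<open>\<nabla>\<^sub>l g\<^bsub>k-bar j\<^esub> - \<nabla>\<^sub>j g\<^bsub>k-bar l\<^esub> = \<chi>\<^bsub>k-bar r\<^esub> T\<^sup>r\<^bsub>lj\<^esub> - g\<^bsub>k-bar r\<^esub> T\<^sup>r\<^bsub>lj\<^esub>\<close>.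
  Put \<open>E\<^bsub>p s-bar j\<^esub> = \<nabla>\<^sub>p g\<^bsub>s-bar j\<^esub> + g\<^bsub>s-bar r\<^esub> T\<^sup>r\<^bsub>pj\<^esub>\<close>. Its \<open>\<chi>\<close>-trace in \<open>p, s\<close> is
  \<open>\<partial>\<^sub>j Tr h + T\<^sub>j\<close>, and expanding squares shows that the difference of the two sides of the claim is
  \<open>|\<partial> Tr h + T|\<^sup>2 / Tr h - |E|\<^sup>2\<close>, which is nonpositive by the Cauchy--Schwarz inequality.
  The \<open>\<partial>\<partial>-bar\<close>-exact case reduces to \<open>\<partial>\<^sub>l \<partial>\<^sub>j = \<partial>\<^sub>j \<partial>\<^sub>l\<close>.\<close>

section \<open>Symmetry of second derivatives\<close>

lemma line_has_derivative:
  fixes f :: "'a::real_normed_vector \<Rightarrow> real"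
  assumes "f differentiable (at (a + s *\<^sub>R u))"
  shows "((\<lambda>s. f (a + s *\<^sub>R u)) has_derivative (\<lambda>h. h * frechet_derivative f (at (a + s *\<^sub>R u)) u))
    (at s within S)"
proof -
  have f: "(f has_derivative frechet_derivative f (at (a + s *\<^sub>R u))) (at (a + s *\<^sub>R u))"
    using assms by (simp add: frechet_derivative_works[symmetric])
  have "((\<lambda>s. f (a + s *\<^sub>R u)) has_derivative
      (\<lambda>h. frechet_derivative f (at (a + s *\<^sub>R u)) (h *\<^sub>R u))) (at s within S)"
    by (rule has_derivative_compose[where f="\<lambda>s. a + s *\<^sub>R u", OF _ f]) (auto intro!: derivative_eq_intros)
  moreover have "frechet_derivative f (at (a + s *\<^sub>R u)) (h *\<^sub>R u) =
      h * frechet_derivative f (at (a + s *\<^sub>R u)) u" for h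
    using linear_frechet_derivative[OF assms] by (simp add: linear_scale)
  ultimately show ?thesis by simp
qed

text \<open>The mean value theorem is used twice: first along \<open>u\<close>, for the difference
  of \<open>f\<close> between the lines through \<open>x + t v\<close> and \<open>x\<close>, then
  along \<open>v\<close>, for the derivative of \<open>f\<close> in the direction
  \<open>u\<close>.\<close>

lemma second_difference:
  fixes f :: "'a::real_normed_vector \<Rightarrow> real"
  assumes C: "C_k_on 2 S f" and t: "0 < t"
    and S: "\<And>s r. s \<in> {0..t} \<Longrightarrow> r \<in> {0..t} \<Longrightarrow> x + s *\<^sub>R u + r *\<^sub>R v \<in> S"
  shows "\<exists>s\<in>{0..t}. \<exists>r\<in>{0..t}.
    f (x + t *\<^sub>R u + t *\<^sub>R v) - f (x + t *\<^sub>R u) - f (x + t *\<^sub>R v) + f x =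
      t\<^sup>2 * frechet_derivative (\<lambda>w. frechet_derivative f (at w) u) (at (x + s *\<^sub>R u + r *\<^sub>R v)) v"
proof -
  have df: "f differentiable (at y)" "(\<lambda>w. frechet_derivative f (at w) u) differentiable (at y)"
    if "y \<in> S" for y
    using C that by (auto simp: numeral_2_eq_2)
  let ?f = "\<lambda>y. frechet_derivative f (at y) u"
  let ?\<phi> = "\<lambda>s. f ((x + t *\<^sub>R v) + s *\<^sub>R u) - f (x + s *\<^sub>R u)"
  have "\<exists>s\<in>{0<..<t}. ?\<phi> t - ?\<phi> 0 =
      (t - 0) * ?f ((x + t *\<^sub>R v) + s *\<^sub>R u) - (t - 0) * ?f (x + s *\<^sub>R u)"
  proof (rule mvt_simple[OF t])
    fix s assume s: "0 \<le> s" "s \<le> t"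
    have "(x + t *\<^sub>R v) + s *\<^sub>R u \<in> S" "x + s *\<^sub>R u \<in> S"
      using S[of s t] S[of s 0] s t by (simp_all add: ac_simps)
    then show "(?\<phi> has_derivative
        (\<lambda>h. h * ?f ((x + t *\<^sub>R v) + s *\<^sub>R u) - h * ?f (x + s *\<^sub>R u))) (at s within {0..t})"
      by (intro has_derivative_diff line_has_derivative df)
  qed
  then obtain s where s: "0 < s" "s < t"
    and \<phi>: "?\<phi> t - ?\<phi> 0 = t * (?f ((x + t *\<^sub>R v) + s *\<^sub>R u) - ?f (x + s *\<^sub>R u))"
    by (auto simp: algebra_simps)
  have "\<exists>r\<in>{0<..<t}. ?f (x + s *\<^sub>R u + t *\<^sub>R v) - ?f (x + s *\<^sub>R u + 0 *\<^sub>R v) =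
      (t - 0) * frechet_derivative ?f (at (x + s *\<^sub>R u + r *\<^sub>R v)) v"
    using s t by (intro mvt_simple[OF t] line_has_derivative df S) auto
  then obtain r where r: "0 < r" "r < t"
    and "?f (x + s *\<^sub>R u + t *\<^sub>R v) - ?f (x + s *\<^sub>R u) =
      t * frechet_derivative ?f (at (x + s *\<^sub>R u + r *\<^sub>R v)) v"
    by auto
  then have "?\<phi> t - ?\<phi> 0 = t\<^sup>2 * frechet_derivative ?f (at (x + s *\<^sub>R u + r *\<^sub>R v)) v"
    unfolding \<phi> by (simp add: power2_eq_square ac_simps)
  then show ?thesis
    using s r by (intro bexI[of _ s] bexI[of _ r]) (simp_all add: ac_simps)
qed

text \<open>The second difference over the parallelogram spanned by \<open>t u\<close> and
  \<open>t v\<close> is symmetric in \<open>u\<close> and \<open>v\<close>. Evaluated in both orders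
  it yields the two mixed derivatives at points near \<open>x\<close>, and their continuity gives
  equality as \<open>t\<close> tends to 0.\<close>

lemma real_mixed_derivatives_commute:
  fixes f :: "'a::real_normed_vector \<Rightarrow> real"
  assumes C: "C_k_on 2 S f" and S: "open S" "x \<in> S"
  shows "frechet_derivative (\<lambda>w. frechet_derivative f (at w) u) (at x) v =
    frechet_derivative (\<lambda>w. frechet_derivative f (at w) v) (at x) u"
proof -
  let ?D = "\<lambda>u v y. frechet_derivative (\<lambda>w. frechet_derivative f (at w) u) (at y) v"
  have cont: "continuous_on S (?D u v)" for u v
    using C by (simp add: numeral_2_eq_2)
  \<comment> \<open>The map from \<open>(s, r)\<close> to \<open>x + s u + r v\<close> is continuous
    at the origin, so for small \<open>t\<close> it sends the whole square over
    \<open>{0..t}\<close> into a given neighbourhood of \<open>x\<close>. All \<open>s\<close> and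
    \<open>r\<close> have to be covered because the mean value points are not known.\<close>
  have close: "\<forall>\<^sub>F t in at_right 0. \<forall>s\<in>{0..t}. \<forall>r\<in>{0..t}. P (x + s *\<^sub>R u + r *\<^sub>R v)"
    if "eventually P (nhds x)" for P and u v :: 'a
  proof -
    have "((\<lambda>z. x + fst z *\<^sub>R u + snd z *\<^sub>R v) \<longlongrightarrow> x + 0 *\<^sub>R u + 0 *\<^sub>R v) (nhds (0, 0))"
      by (rule tendsto_eq_intros filterlim_ident tendsto_fst tendsto_snd | simp)+
    then have "\<forall>\<^sub>F z in nhds (0::real, 0::real). P (x + fst z *\<^sub>R u + snd z *\<^sub>R v)"
      using that by (auto dest: filterlim_iff[THEN iffD1])
    then obtain A B where "open A" "open B" "0 \<in> A" "0 \<in> B"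
      and AB: "\<And>s r. s \<in> A \<Longrightarrow> r \<in> B \<Longrightarrow> P (x + s *\<^sub>R u + r *\<^sub>R v)"
      unfolding nhds_prod eventually_prod_filter eventually_nhds by force
    then have "open (A \<inter> B)" "0 \<in> A \<inter> B" by auto
    then obtain d where d: "d > 0" "ball 0 d \<subseteq> A \<inter> B" by (metis open_contains_ball)
    have "\<forall>\<^sub>F t in at_right 0. 0 < t \<and> t < d"
      using d(1) by (auto simp: eventually_at_right)
    then show ?thesis
    proof eventually_elim
      case (elim t)
      then have "s \<in> A \<inter> B" if "s \<in> {0..t}" for s
        using that d(2) by (auto simp: subset_eq)
      then show ?case using AB by auto
    qed
  qed
  have near: "\<forall>\<^sub>F y in nhds x. y \<in> S \<and> dist (?D u v y) (?D u v x) < e"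
    if "e > 0" for e u v
  proof -
    have "isCont (?D u v) x"
      using cont S by (simp add: continuous_on_eq_continuous_at)
    then have "\<forall>\<^sub>F y in nhds x. dist (?D u v y) (?D u v x) < e"
      using that unfolding continuous_at_eps_delta eventually_nhds_metric by blast
    then show ?thesis
      using S by (simp add: eventually_conj eventually_nhds_in_open)
  qed
  have "\<bar>?D u v x - ?D v u x\<bar> < 2 * e" if e: "e > 0" for e
  proof -
    have "\<forall>\<^sub>F t in at_right (0::real). 0 < t" by (simp add: eventually_at_right_less)
    then have "\<forall>\<^sub>F t in at_right (0::real). 0 < t \<and>
        (\<forall>s\<in>{0..t}. \<forall>r\<in>{0..t}. x + s *\<^sub>R u + r *\<^sub>R v \<in> S \<and>
          dist (?D u v (x + s *\<^sub>R u + r *\<^sub>R v)) (?D u v x) < e) \<and>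
        (\<forall>s\<in>{0..t}. \<forall>r\<in>{0..t}. x + s *\<^sub>R v + r *\<^sub>R u \<in> S \<and>
          dist (?D v u (x + s *\<^sub>R v + r *\<^sub>R u)) (?D v u x) < e)"
      by (intro eventually_conj close[OF near[OF e]])
    from eventually_happens'[OF trivial_limit_at_right_real this] obtain t where t: "0 < t"
      and uv: "\<forall>s\<in>{0..t}. \<forall>r\<in>{0..t}. x + s *\<^sub>R u + r *\<^sub>R v \<in> S \<and>
          dist (?D u v (x + s *\<^sub>R u + r *\<^sub>R v)) (?D u v x) < e"
      and vu: "\<forall>s\<in>{0..t}. \<forall>r\<in>{0..t}. x + s *\<^sub>R v + r *\<^sub>R u \<in> S \<and>
          dist (?D v u (x + s *\<^sub>R v + r *\<^sub>R u)) (?D v u x) < e"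
      by (elim exE conjE)
    note uvS = uv[THEN bspec, THEN bspec, THEN conjunct1]
    note vuS = vu[THEN bspec, THEN bspec, THEN conjunct1]
    note uve = uv[THEN bspec, THEN bspec, THEN conjunct2]
    note vue = vu[THEN bspec, THEN bspec, THEN conjunct2]
    obtain s r where sr: "s \<in> {0..t}" "r \<in> {0..t}"
      and 1: "f (x + t *\<^sub>R u + t *\<^sub>R v) - f (x + t *\<^sub>R u) - f (x + t *\<^sub>R v) + f x =
        t\<^sup>2 * ?D u v (x + s *\<^sub>R u + r *\<^sub>R v)"
      by (rule bexE[OF second_difference[OF C t, of x u v, OF uvS]]) (assumption | elim bexE)+
    obtain s' r' where sr': "s' \<in> {0..t}" "r' \<in> {0..t}"
      and 2: "f (x + t *\<^sub>R v + t *\<^sub>R u) - f (x + t *\<^sub>R v) - f (x + t *\<^sub>R u) + f x =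
        t\<^sup>2 * ?D v u (x + s' *\<^sub>R v + r' *\<^sub>R u)"
      by (rule bexE[OF second_difference[OF C t, of x v u, OF vuS]]) (assumption | elim bexE)+
    have "t\<^sup>2 * ?D u v (x + s *\<^sub>R u + r *\<^sub>R v) = t\<^sup>2 * ?D v u (x + s' *\<^sub>R v + r' *\<^sub>R u)"
    proof -
      have "x + t *\<^sub>R u + t *\<^sub>R v = x + t *\<^sub>R v + t *\<^sub>R u" by (simp add: ac_simps)
      then have "f (x + t *\<^sub>R u + t *\<^sub>R v) - f (x + t *\<^sub>R u) - f (x + t *\<^sub>R v) + f x =
          f (x + t *\<^sub>R v + t *\<^sub>R u) - f (x + t *\<^sub>R v) - f (x + t *\<^sub>R u) + f x"
        by (simp only:)
      with 1 2 show ?thesis by (simp only:)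
    qed
    then have "?D u v (x + s *\<^sub>R u + r *\<^sub>R v) = ?D v u (x + s' *\<^sub>R v + r' *\<^sub>R u)"
      using t by simp
    moreover have "dist (?D u v (x + s *\<^sub>R u + r *\<^sub>R v)) (?D u v x) < e"
      "dist (?D v u (x + s' *\<^sub>R v + r' *\<^sub>R u)) (?D v u x) < e"
      using uve[OF sr] vue[OF sr'] .
    ultimately show ?thesis by (simp add: dist_real_def)
  qed
  \<comment> \<open>If the two derivatives differed, half of their distance would be an admissible
    \<open>e\<close>, and the distance would be smaller than itself.\<close>
  from this[of "\<bar>?D u v x - ?D v u x\<bar> / 2"] show ?thesis by argo
qed

section \<open>Stability of the classes \<open>C_k_on\<close>\<close>

lemma C_k_on_cong:
  fixes f g :: "'a::real_normed_vector \<Rightarrow> 'b::real_normed_vector"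
  assumes "open S" "\<And>x. x \<in> S \<Longrightarrow> f x = g x"
  shows "C_k_on k S f \<longleftrightarrow> C_k_on k S g"
  using assms(2)
proof (induction k arbitrary: f g)
  case 0
  then show ?case by (simp cong: continuous_on_cong)
next
  case (Suc k)
  \<comment> \<open>Openness makes the derivative at a point of \<open>S\<close> depend only on the
    values on \<open>S\<close>. The implication is proved for an arbitrary pair, so that it can be
    used in both directions.\<close>
  have imp: "C_k_on (Suc k) S g" if C: "C_k_on (Suc k) S f" and fg: "\<And>x. x \<in> S \<Longrightarrow> f x = g x"
    for f g :: "'a \<Rightarrow> 'b"
  proof -
    have d: "f differentiable (at x)" if "x \<in> S" for x
      using C that by simp
    have "frechet_derivative g (at x) = frechet_derivative f (at x)" if "x \<in> S" for x
      using frechet_derivative_transform_within_open[OF d assms(1) that] fg that by metis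
    then have "C_k_on k S (\<lambda>x. frechet_derivative g (at x) v) =
        C_k_on k S (\<lambda>x. frechet_derivative f (at x) v)" for v
      by (intro Suc.IH) simp
    moreover have "g differentiable (at x)" if "x \<in> S" for x
      using has_derivative_transform_within_open[OF _ assms(1) that, of f _ UNIV g] fg d[OF that]
      unfolding differentiable_def by blast
    ultimately show ?thesis
      using C by simp
  qed
  show ?case using imp[of f g] imp[of g f] Suc.prems by metis
qed

lemma frechet_derivative_linear:
  assumes "bounded_linear L" "f differentiable (at x)"
  shows "frechet_derivative (\<lambda>x. L (f x)) (at x) v = L (frechet_derivative f (at x) v)"
proof -
  have "((\<lambda>x. L (f x)) has_derivative (\<lambda>v. L (frechet_derivative f (at x) v))) (at x)"
    using assms by (intro bounded_linear.has_derivative[OF assms(1)])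
      (simp add: frechet_derivative_works[symmetric])
  from frechet_derivative_at[OF this] show ?thesis by metis
qed

lemma C_k_on_linear:
  assumes "open S" "bounded_linear L" "C_k_on k S f"
  shows "C_k_on k S (\<lambda>x. L (f x))"
  using assms(3)
proof (induction k arbitrary: f)
  case 0
  then show ?case using bounded_linear.continuous_on[OF assms(2)] by simp
next
  case (Suc k)
  have "(\<lambda>x. L (f x)) differentiable (at x)" if "x \<in> S" for x
    using Suc.prems that bounded_linear.has_derivative[OF assms(2)]
    by (auto simp: differentiable_def) blast
  moreover have "C_k_on k S (\<lambda>x. frechet_derivative (\<lambda>x. L (f x)) (at x) v)" for v
    using C_k_on_cong[OF assms(1), where f="\<lambda>x. frechet_derivative (\<lambda>x. L (f x)) (at x) v"
        and g="\<lambda>x. L (frechet_derivative f (at x) v)"]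
      Suc by (simp add: frechet_derivative_linear[OF assms(2)])
  ultimately show ?case by simp
qed

lemma frechet_derivative_add:
  assumes "f differentiable (at x)" "g differentiable (at x)"
  shows "frechet_derivative (\<lambda>x. f x + g x) (at x) v =
    frechet_derivative f (at x) v + frechet_derivative g (at x) v"
proof -
  have "((\<lambda>x. f x + g x) has_derivative
      (\<lambda>v. frechet_derivative f (at x) v + frechet_derivative g (at x) v)) (at x)"
    using assms by (intro has_derivative_add) (simp_all add: frechet_derivative_works[symmetric])
  from frechet_derivative_at[OF this] show ?thesis by metis
qed

lemma C_k_on_add:
  assumes "open S" "C_k_on k S f" "C_k_on k S g"
  shows "C_k_on k S (\<lambda>x. f x + g x)"
  using assms(2,3)
proof (induction k arbitrary: f g)
  case 0
  then show ?case by (simp add: continuous_on_add)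
next
  case (Suc k)
  have "C_k_on k S (\<lambda>x. frechet_derivative (\<lambda>x. f x + g x) (at x) v)" for v
    using C_k_on_cong[OF assms(1), where f="\<lambda>x. frechet_derivative (\<lambda>x. f x + g x) (at x) v"
        and g="\<lambda>x. frechet_derivative f (at x) v + frechet_derivative g (at x) v"]
      Suc by (simp add: frechet_derivative_add)
  then show ?case using Suc.prems by (simp add: differentiable_add)
qed

text \<open>The inner product with a basis vector is bounded linear and so commutes with
  differentiation; the real case then applies to each component.\<close>

lemma mixed_derivatives_commute:
  fixes f :: "'a::real_normed_vector \<Rightarrow> 'b::euclidean_space"
  assumes C: "C_k_on 2 S f" and S: "open S" "x \<in> S"
  shows "frechet_derivative (\<lambda>w. frechet_derivative f (at w) u) (at x) v =
    frechet_derivative (\<lambda>w. frechet_derivative f (at w) v) (at x) u"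
proof (rule euclidean_eqI)
  fix b :: 'b
  have d: "f differentiable (at y)" "(\<lambda>w. frechet_derivative f (at w) u) differentiable (at y)"
    if "y \<in> S" for y u
    using C that by (auto simp: numeral_2_eq_2)
  have *: "frechet_derivative (\<lambda>w. frechet_derivative (\<lambda>w. f w \<bullet> b) (at w) u) (at x) v =
      frechet_derivative (\<lambda>w. frechet_derivative f (at w) u) (at x) v \<bullet> b" for u v
  proof -
    have "((\<lambda>w. frechet_derivative f (at w) u \<bullet> b) differentiable (at x))"
      using d(2)[OF S(2)] by (simp add: differentiable_inner)
    from frechet_derivative_transform_within_open[OF this S, of "\<lambda>w. frechet_derivative (\<lambda>w. f w \<bullet> b) (at w) u"]
    have "frechet_derivative (\<lambda>w. frechet_derivative (\<lambda>w. f w \<bullet> b) (at w) u) (at x) =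
        frechet_derivative (\<lambda>w. frechet_derivative f (at w) u \<bullet> b) (at x)"
      by (simp add: frechet_derivative_linear[OF bounded_linear_inner_left] d)
    then show ?thesis by (simp add: frechet_derivative_linear[OF bounded_linear_inner_left] d S)
  qed
  have "C_k_on 2 S (\<lambda>w. f w \<bullet> b)"
    using C_k_on_linear[OF S(1) bounded_linear_inner_left C] .
  from real_mixed_derivatives_commute[OF this S, of u v]
  show "frechet_derivative (\<lambda>w. frechet_derivative f (at w) u) (at x) v \<bullet> b =
    frechet_derivative (\<lambda>w. frechet_derivative f (at w) v) (at x) u \<bullet> b"
    unfolding * .
qed

section \<open>Positivity of contractions\<close>

text \<open>This is the Cholesky factorisation. Splitting off one index \<open>k\<close> leaves the
  Schur complement, which is again Hermitian and positive definite, and a factor of it is extended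
  by one column.\<close>

lemma gram_decomposition:
  fixes M :: "'i \<Rightarrow> 'i \<Rightarrow> complex"
  assumes "finite I"
    and "\<And>i j. i \<in> I \<Longrightarrow> j \<in> I \<Longrightarrow> M i j = cnj (M j i)"
    and "\<And>x. \<exists>i\<in>I. x i \<noteq> 0 \<Longrightarrow> 0 < Re (\<Sum>i\<in>I. \<Sum>j\<in>I. M i j * x i * cnj (x j))"
  shows "\<exists>B. \<forall>i\<in>I. \<forall>j\<in>I. M i j = (\<Sum>a\<in>I. B i a * cnj (B j a))"
  using assms
proof (induction I arbitrary: M rule: finite_induct)
  case empty
  then show ?case by simp
next
  case (insert k I)
  define m where "m = Re (M k k)"
  have "M k k = cnj (M k k)" by (rule insert.prems(1)) simp_all
  then have m: "M k k = of_real m"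
    by (simp add: m_def complex_eq_iff)
  \<comment> \<open>Testing positivity on the basis vector of index \<open>k\<close> shows that the
    pivot \<open>m\<close> is positive.\<close>
  have "0 < Re (\<Sum>i\<in>insert k I. \<Sum>j\<in>insert k I.
      M i j * (if i = k then 1 else 0) * cnj (if j = k then 1 else 0))"
    by (rule insert.prems(2)) auto
  also have "(\<Sum>i\<in>insert k I. \<Sum>j\<in>insert k I.
      M i j * (if i = k then 1 else 0) * cnj (if j = k then 1 else 0)) =
      (\<Sum>i\<in>insert k I. if i = k then \<Sum>j\<in>insert k I. if j = k then M k k else 0 else 0)"
    by (intro sum.cong refl) (auto intro!: sum.cong)
  also have "\<dots> = M k k" using insert.hyps by simp
  finally have m_pos: "m > 0" by (simp add: m)
  \<comment> \<open>The Schur complement of the pivot \<open>M k k\<close>.\<close>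
  define M' where "M' = (\<lambda>i j. M i j - M i k * M k j / of_real m)"
  have herm: "M i j = cnj (M j i)" if "i \<in> insert k I" "j \<in> insert k I" for i j
    using insert.prems(1) that .
  have "\<exists>B. \<forall>i\<in>I. \<forall>j\<in>I. M' i j = (\<Sum>a\<in>I. B i a * cnj (B j a))"
  proof (rule insert.IH)
    fix i j assume "i \<in> I" "j \<in> I"
    then show "M' i j = cnj (M' j i)"
      unfolding M'_def using herm[of i j] herm[of i k] herm[of k j] by (simp add: mult.commute)
  next
    fix y :: "'i \<Rightarrow> complex" assume y: "\<exists>i\<in>I. y i \<noteq> 0"
    define a where "a = (\<Sum>i\<in>I. M i k * y i)"
    have cnj_a: "cnj a = (\<Sum>j\<in>I. M k j * cnj (y j))"
      unfolding a_def cnj_sum by (intro sum.cong refl) (simp add: herm[of k])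
    \<comment> \<open>The coordinate at \<open>k\<close> is chosen to complete the square: with this
      value the form of \<open>M\<close> at \<open>x\<close> equals the form of \<open>M'\<close> at
      \<open>y\<close>.\<close>
    define x where "x = y(k := - a / of_real m)"
    have x: "x i = y i" if "i \<in> I" for i using that insert.hyps by (auto simp: x_def)
    have "(\<Sum>i\<in>insert k I. \<Sum>j\<in>insert k I. M i j * x i * cnj (x j)) =
        M k k * x k * cnj (x k) + (\<Sum>j\<in>I. M k j * x k * cnj (y j))
        + ((\<Sum>i\<in>I. M i k * y i * cnj (x k)) + (\<Sum>i\<in>I. \<Sum>j\<in>I. M i j * y i * cnj (y j)))"
      using insert.hyps by (simp add: sum.distrib x cong: sum.cong)
    also have "(\<Sum>j\<in>I. M k j * x k * cnj (y j)) = x k * cnj a"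
      unfolding cnj_a sum_distrib_left by (simp add: ac_simps)
    also have "(\<Sum>i\<in>I. M i k * y i * cnj (x k)) = a * cnj (x k)"
      unfolding a_def sum_distrib_right ..
    also have "M k k * x k * cnj (x k) + x k * cnj a
        + (a * cnj (x k) + (\<Sum>i\<in>I. \<Sum>j\<in>I. M i j * y i * cnj (y j))) =
        (\<Sum>i\<in>I. \<Sum>j\<in>I. M i j * y i * cnj (y j)) - a * cnj a / of_real m"
      using m_pos by (simp add: x_def m field_simps)
    also have "a * cnj a / of_real m = (\<Sum>i\<in>I. \<Sum>j\<in>I. M i k * M k j / of_real m * y i * cnj (y j))"
      unfolding cnj_a unfolding a_def sum_product sum_divide_distrib
      by (intro sum.cong refl) (simp add: ac_simps)
    finally have "(\<Sum>i\<in>insert k I. \<Sum>j\<in>insert k I. M i j * x i * cnj (x j)) =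
        (\<Sum>i\<in>I. \<Sum>j\<in>I. M' i j * y i * cnj (y j))"
      by (simp add: M'_def left_diff_distrib sum_subtractf)
    moreover have "0 < Re (\<Sum>i\<in>insert k I. \<Sum>j\<in>insert k I. M i j * x i * cnj (x j))"
      using y x by (intro insert.prems(2)) auto
    ultimately show "0 < Re (\<Sum>i\<in>I. \<Sum>j\<in>I. M' i j * y i * cnj (y j))" by simp
  qed
  then obtain B where B: "\<And>i j. i \<in> I \<Longrightarrow> j \<in> I \<Longrightarrow> M' i j = (\<Sum>a\<in>I. B i a * cnj (B j a))"
    by blast
  \<comment> \<open>The new column is the column \<open>k\<close> of \<open>M\<close> divided by
    \<open>sqrt m\<close>. Its products supply exactly the terms subtracted in \<open>M'\<close>,
    and the row \<open>k\<close> vanishes outside this column.\<close>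
  define B' where "B' = (\<lambda>i a. if a = k then M i k / of_real (sqrt m) else if i = k then 0 else B i a)"
  have sq: "complex_of_real (sqrt m) * complex_of_real (sqrt m) = of_real m"
    using m_pos by (simp flip: of_real_mult)
  have "M i j = (\<Sum>a\<in>insert k I. B' i a * cnj (B' j a))" if "i \<in> insert k I" "j \<in> insert k I" for i j
  proof -
    have "B' i k * cnj (B' j k) = M i k * M k j / of_real m"
      using herm[OF that(2), of k] by (simp add: B'_def sq)
    moreover have "(\<Sum>a\<in>I. B' i a * cnj (B' j a)) = (if i = k \<or> j = k then 0 else M' i j)"
    proof (cases "i = k \<or> j = k")
      case True
      then show ?thesis using insert.hyps by (auto simp: B'_def intro!: sum.neutral)
    next
      case False
      then show ?thesis using that insert.hyps by (auto simp: B'_def B intro!: sum.cong)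
    qed
    ultimately show ?thesis
      using insert.hyps m_pos by (auto simp: M'_def m)
  qed
  then show ?case by blast
qed

text \<open>The components \<open>E\<^bsub>p s-bar j\<^esub>\<close> are written \<open>E p s j\<close>, and \<open>T\<^sup>m\<^bsub>p j\<^esub>\<close> is written \<open>T m p j\<close>. In
  \<open>contract2\<close> the first argument is of the former and the second of the latter kind.\<close>

definition contract1 where
  "contract1 gi N M = (\<Sum>j\<in>UNIV. \<Sum>k\<in>UNIV. gi j k * N j * cnj (M k :: complex))"

definition contract2 where
  "contract2 ci gi X Y = (\<Sum>p\<in>UNIV. \<Sum>q\<in>UNIV. \<Sum>j\<in>UNIV. \<Sum>k\<in>UNIV. \<Sum>s\<in>UNIV.
     ci p q * gi j k * X p s j * cnj (Y s q k :: complex))"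

text \<open>This is the Hermitian product of tensors such as \<nabla>g. The middle index is barred,
  so in \<open>gi r s\<close> it is \<open>s\<close>, the barred place, that belongs to
  \<open>E\<close>, while conjugation makes the middle index \<open>r\<close> of \<open>F\<close>
  unbarred.\<close>

definition contract3 where
  "contract3 ci gi E F = (\<Sum>p\<in>UNIV. \<Sum>q\<in>UNIV. \<Sum>j\<in>UNIV. \<Sum>k\<in>UNIV. \<Sum>r\<in>UNIV. \<Sum>s\<in>UNIV.
     ci p q * gi j k * gi r s * E p s j * cnj (F q r k :: complex))"

definition lower where
  "lower g T p s j = (\<Sum>m\<in>UNIV. g s m * (T m p j :: complex))"

section \<open>Sesquilinearity and conjugation rules of the contractions\<close>

lemma contract1_add_left:
  "contract1 gi (\<lambda>j. N j + N' j) M = contract1 gi N M + contract1 gi N' M"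
  unfolding contract1_def by (simp add: distrib_left distrib_right sum.distrib)

lemma contract1_add_right:
  "contract1 gi N (\<lambda>j. M j + M' j) = contract1 gi N M + contract1 gi N M'"
  unfolding contract1_def by (simp add: distrib_left distrib_right sum.distrib)

lemma contract2_add_left:
  "contract2 ci gi (\<lambda>p s j. X p s j + X' p s j) Y = contract2 ci gi X Y + contract2 ci gi X' Y"
  unfolding contract2_def by (simp add: distrib_left distrib_right sum.distrib)

lemma contract2_diff_left:
  "contract2 ci gi (\<lambda>p s j. X p s j - X' p s j) Y = contract2 ci gi X Y - contract2 ci gi X' Y"
  unfolding contract2_def by (simp add: left_diff_distrib right_diff_distrib sum_subtractf)

lemma contract3_add_left:
  "contract3 ci gi (\<lambda>p s j. E p s j + E' p s j) F = contract3 ci gi E F + contract3 ci gi E' F"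
  unfolding contract3_def by (simp add: distrib_left distrib_right sum.distrib)

lemma contract3_add_right:
  "contract3 ci gi E (\<lambda>p s j. F p s j + F' p s j) = contract3 ci gi E F + contract3 ci gi E F'"
  unfolding contract3_def by (simp add: distrib_left distrib_right sum.distrib)

lemma contract3_scale_left:
  "contract3 ci gi (\<lambda>p s j. t * E p s j) F = t * contract3 ci gi E F"
  unfolding contract3_def by (simp add: sum_distrib_left ac_simps)

lemma contract3_scale_right:
  "contract3 ci gi E (\<lambda>p s j. t * F p s j) = cnj t * contract3 ci gi E F"
  unfolding contract3_def by (simp add: sum_distrib_left ac_simps)

text \<open>Conjugation transposes the Hermitian weights \<open>ci\<close> and \<open>gi\<close>;
  this renaming of the summation indices transposes them back.\<close>

lemma sum_swap_pairs2:
  "(\<Sum>p\<in>UNIV. \<Sum>q\<in>UNIV. \<Sum>j\<in>UNIV. \<Sum>k\<in>UNIV. f p q j k :: complex) =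
   (\<Sum>p\<in>UNIV. \<Sum>q\<in>UNIV. \<Sum>j\<in>UNIV. \<Sum>k\<in>UNIV. f q p k j)"
  by (subst sum.swap, intro sum.cong refl, subst sum.swap) (rule refl)

lemma sum_swap_pairs3:
  "(\<Sum>p\<in>UNIV. \<Sum>q\<in>UNIV. \<Sum>j\<in>UNIV. \<Sum>k\<in>UNIV. \<Sum>r\<in>UNIV. \<Sum>s\<in>UNIV. f p q j k r s :: complex) =
   (\<Sum>p\<in>UNIV. \<Sum>q\<in>UNIV. \<Sum>j\<in>UNIV. \<Sum>k\<in>UNIV. \<Sum>r\<in>UNIV. \<Sum>s\<in>UNIV. f q p k j s r)"
  by (subst sum_swap_pairs2, intro sum.cong refl, subst sum.swap) (rule refl)

lemma contract1_cnj:
  assumes "\<forall>j k. cnj (gi j k) = gi k j"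
  shows "cnj (contract1 gi N M) = contract1 gi M N"
  unfolding contract1_def cnj_sum by (subst sum.swap) (simp add: assms ac_simps)

text \<open>The right-hand side has the shape of the fourth term of the claim, in which the
  derivative of g is conjugated and the torsion is not.\<close>

lemma contract2_cnj:
  assumes "\<forall>p q. cnj (ci p q) = ci q p" "\<forall>j k. cnj (gi j k) = gi k j"
  shows "cnj (contract2 ci gi X Y) = (\<Sum>p\<in>UNIV. \<Sum>q\<in>UNIV. \<Sum>j\<in>UNIV. \<Sum>k\<in>UNIV. \<Sum>s\<in>UNIV.
    ci p q * gi j k * cnj (X q s k) * Y s p j)"
  unfolding contract2_def cnj_sum by (subst sum_swap_pairs2) (simp add: assms)

lemma contract3_cnj:
  assumes "\<forall>p q. cnj (ci p q) = ci q p" "\<forall>j k. cnj (gi j k) = gi k j"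
  shows "cnj (contract3 ci gi E F) = contract3 ci gi F E"
  unfolding contract3_def cnj_sum by (subst sum_swap_pairs3) (simp add: assms ac_simps)

text \<open>Identifies the quadratic torsion term of the claim as a \<open>contract2\<close> and
  puts it into a form whose Hermitian symmetry is visible.\<close>

lemma contract2_lower:
  "contract2 ci gi (lower c X) Y =
    (\<Sum>p\<in>UNIV. \<Sum>q\<in>UNIV. \<Sum>j\<in>UNIV. \<Sum>k\<in>UNIV. \<Sum>r\<in>UNIV. \<Sum>s\<in>UNIV.
      ci p q * gi j k * c s r * X r p j * cnj (Y s q k))"
  unfolding contract2_def lower_def sum_distrib_left sum_distrib_right
  by (subst (6) sum.swap) (simp add: ac_simps)

lemma contract2_lower_cnj:
  assumes "\<forall>p q. cnj (ci p q) = ci q p" "\<forall>j k. cnj (gi j k) = gi k j" "\<forall>j k. cnj (c j k) = c k j"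
  shows "cnj (contract2 ci gi (lower c X) Y) = contract2 ci gi (lower c Y) X"
  unfolding contract2_lower cnj_sum by (subst sum_swap_pairs3) (simp add: assms ac_simps)

text \<open>The weight \<open>gi r s\<close> cancels the matrix \<open>g\<close> with which the
  index of \<open>Y\<close> was lowered. Mixed terms in the expansion of a square norm thereby
  become contractions with the torsion itself.\<close>

lemma contract3_lower:
  fixes g gi :: "'n::finite \<Rightarrow> 'n \<Rightarrow> complex"
  assumes "\<forall>j k. cnj (g j k) = g k j"
    and "\<forall>j k. (\<Sum>r\<in>UNIV. g j r * gi r k) = (if j = k then 1 else 0)"
  shows "contract3 ci gi X (lower g Y) = contract2 ci gi X Y"
proof -
  have "(\<Sum>r\<in>UNIV. \<Sum>s\<in>UNIV. a * b * gi r s * X p s j * cnj (lower g Y q r k)) =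
      (\<Sum>s\<in>UNIV. a * b * X p s j * cnj (Y s q k))" for a b p q j k
  proof -
    have "(\<Sum>r\<in>UNIV. \<Sum>s\<in>UNIV. a * b * gi r s * X p s j * cnj (lower g Y q r k)) =
        (\<Sum>s\<in>UNIV. \<Sum>r\<in>UNIV. \<Sum>m\<in>UNIV. a * b * X p s j * cnj (Y m q k) * (g m r * gi r s))"
      by (subst sum.swap) (simp add: lower_def sum_distrib_left assms(1) ac_simps)
    also have "\<dots> = (\<Sum>s\<in>UNIV. \<Sum>m\<in>UNIV. a * b * X p s j * cnj (Y m q k) * (\<Sum>r\<in>UNIV. g m r * gi r s))"
      unfolding sum_distrib_left by (intro sum.cong refl sum.swap)
    also have "\<dots> = (\<Sum>s\<in>UNIV. a * b * X p s j * cnj (Y s q k))"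
      unfolding assms(2)[rule_format] by (simp add: if_distrib cong: if_cong)
    finally show ?thesis .
  qed
  then show ?thesis unfolding contract3_def contract2_def by simp
qed

section \<open>Nonnegativity of the Hermitian product of tensors\<close>

lemma gram_product:
  fixes K :: "'i::finite \<Rightarrow> 'i \<Rightarrow> complex" and L :: "'j::finite \<Rightarrow> 'j \<Rightarrow> complex"
  assumes "\<And>p q. K p q = (\<Sum>a\<in>UNIV. B p a * cnj (B q a))"
    and "\<And>j k. L j k = (\<Sum>b\<in>UNIV. C j b * cnj (C k b))"
  shows "K p q * L j k = (\<Sum>(a, b)\<in>UNIV. (B p a * C j b) * cnj (B q a * C k b))"
  unfolding assms sum_product sum.cartesian_product UNIV_Times_UNIV
  by (intro sum.cong refl) (auto simp: ac_simps)

text \<open>For a Gram matrix the form is a sum over \<open>a\<close> of the squared moduli of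
  \<open>\<Sum>x. W x a * f x\<close>.\<close>

lemma gram_nonneg:
  fixes W :: "'a::finite \<Rightarrow> 'b::finite \<Rightarrow> complex"
  shows "0 \<le> Re (\<Sum>x\<in>UNIV. \<Sum>y\<in>UNIV. (\<Sum>a\<in>UNIV. W x a * cnj (W y a)) * f x * cnj (f y))"
proof -
  have "(\<Sum>x\<in>UNIV. \<Sum>y\<in>UNIV. (\<Sum>a\<in>UNIV. W x a * cnj (W y a)) * f x * cnj (f y)) =
      (\<Sum>x\<in>UNIV. \<Sum>a\<in>UNIV. \<Sum>y\<in>UNIV. W x a * cnj (W y a) * f x * cnj (f y))"
    unfolding sum_distrib_right by (intro sum.cong refl sum.swap)
  also have "\<dots> = (\<Sum>a\<in>UNIV. (\<Sum>x\<in>UNIV. W x a * f x) * cnj (\<Sum>x\<in>UNIV. W x a * f x))"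
    unfolding cnj_sum sum_product by (subst sum.swap) (simp add: ac_simps)
  also have "Re \<dots> \<ge> 0"
    unfolding Re_sum complex_mult_cnj by (intro sum_nonneg) simp
  finally show ?thesis .
qed

lemma contract1_gram:
  fixes K :: "'n::finite \<Rightarrow> 'n \<Rightarrow> complex"
  assumes herm: "\<forall>p q. cnj (K p q) = K q p"
    and pos: "\<forall>x. (\<exists>i. x i \<noteq> 0) \<longrightarrow> 0 < Re (contract1 K x x)"
  shows "\<exists>B. \<forall>p q. K p q = (\<Sum>a\<in>(UNIV :: 'n set). B p a * cnj (B q a))"
proof -
  have "\<exists>B. \<forall>i\<in>UNIV. \<forall>j\<in>UNIV. K i j = (\<Sum>a\<in>(UNIV :: 'n set). B i a * cnj (B j a))"
  proof (rule gram_decomposition)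
    show "K i j = cnj (K j i)" for i j by (simp add: herm)
    show "0 < Re (\<Sum>i\<in>UNIV. \<Sum>j\<in>UNIV. K i j * x i * cnj (x j))" if "\<exists>i\<in>UNIV. x i \<noteq> 0" for x
      using pos that by (simp add: contract1_def del: Re_sum)
  qed simp
  then show ?thesis by simp
qed

text \<open>On index triples \<open>(p, j, s)\<close> the weight is the Kronecker product of
  \<open>ci\<close>, \<open>gi\<close> and the transpose of \<open>gi\<close>. Each has a Gram
  factor, and the products of these factors form a Gram factor \<open>W\<close> of the whole
  weight.\<close>

lemma contract3_nonneg:
  fixes ci :: "'n::finite \<Rightarrow> 'n \<Rightarrow> complex" and gi :: "'m::finite \<Rightarrow> 'm \<Rightarrow> complex"
  assumes "\<forall>p q. cnj (ci p q) = ci q p" "\<forall>j k. cnj (gi j k) = gi k j"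
    and "\<forall>x. (\<exists>i. x i \<noteq> 0) \<longrightarrow> 0 < Re (contract1 ci x x)"
    and "\<forall>x. (\<exists>i. x i \<noteq> 0) \<longrightarrow> 0 < Re (contract1 gi x x)"
  shows "0 \<le> Re (contract3 ci gi E E)"
proof -
  obtain B :: "'n \<Rightarrow> 'n \<Rightarrow> complex" where B: "\<And>p q. ci p q = (\<Sum>a\<in>UNIV. B p a * cnj (B q a))"
    using contract1_gram[OF assms(1,3)] by blast
  obtain C :: "'m \<Rightarrow> 'm \<Rightarrow> complex" where C: "\<And>p q. gi p q = (\<Sum>a\<in>UNIV. C p a * cnj (C q a))"
    using contract1_gram[OF assms(2,4)] by blast
  \<comment> \<open>In \<open>gi r s\<close> the index \<open>s\<close> of the unconjugated tensor
    stands second, so the transposed matrix is factored; its Gram factor is the conjugate of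
    \<open>C\<close>.\<close>
  have C': "gi r s = (\<Sum>a\<in>UNIV. cnj (C s a) * cnj (cnj (C r a)))" for r s
    by (simp add: C mult.commute)
  define W where "W = (\<lambda>(p, j, s) (a, b, d). B p a * (C j b * cnj (C s d)))"
  have "ci p q * (gi j k * gi r s) = (\<Sum>x\<in>UNIV. W (p, j, s) x * cnj (W (q, k, r) x))" for p q j k r s
  proof -
    have 1: "gi j k * gi r s = (\<Sum>x\<in>UNIV. (\<lambda>(j, s) (b, d). C j b * cnj (C s d)) (j, s) x *
        cnj ((\<lambda>(j, s) (b, d). C j b * cnj (C s d)) (k, r) x))" for j k r s
      using gram_product[of gi C "\<lambda>s r. gi r s" "\<lambda>s a. cnj (C s a)" j k s r, OF C C']
      by (simp add: case_prod_unfold)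
    from gram_product[of ci B "\<lambda>x y. gi (fst x) (fst y) * gi (snd y) (snd x)"
        "\<lambda>(j, s) (b, d). C j b * cnj (C s d)" p q "(j, s)" "(k, r)", OF B] 1
    show ?thesis by (simp add: W_def case_prod_unfold)
  qed
  then have "contract3 ci gi E E = (\<Sum>p\<in>UNIV. \<Sum>q\<in>UNIV. \<Sum>j\<in>UNIV. \<Sum>k\<in>UNIV. \<Sum>r\<in>UNIV. \<Sum>s\<in>UNIV.
     (\<Sum>x\<in>UNIV. W (p, j, s) x * cnj (W (q, k, r) x)) * E p s j * cnj (E q r k))"
    by (simp add: contract3_def mult.assoc)
  also have "\<dots> = (\<Sum>x\<in>UNIV. \<Sum>y\<in>UNIV. (\<Sum>a\<in>UNIV. W x a * cnj (W y a)) *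
      (case x of (p, j, s) \<Rightarrow> E p s j) * cnj (case y of (q, k, r) \<Rightarrow> E q r k))"
    unfolding sum.cartesian_product UNIV_Times_UNIV
    by (rule sum.reindex_bij_witness[where i = "\<lambda>((p, j, s), (q, k, r)). (p, q, j, k, r, s)"
          and j = "\<lambda>(p, q, j, k, r, s). ((p, j, s), (q, k, r))"]) auto
  also have "Re \<dots> \<ge> 0"
    by (rule gram_nonneg)
  finally show ?thesis .
qed

text \<open>The Kronecker delta sets \<open>s = q\<close>, which turns the contraction into a trace
  of \<open>X\<close> against \<open>ci\<close>. Lowered with \<open>g\<close>, this diagonal tensor
  is the one compared with \<open>E\<close> in the Cauchy--Schwarz inequality.\<close>

lemma contract2_diagonal:
  fixes ci :: "'n::finite \<Rightarrow> 'n \<Rightarrow> complex" and gi :: "'m::finite \<Rightarrow> 'm \<Rightarrow> complex"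
  shows
  "contract2 ci gi X (\<lambda>m p j. if m = p then N j else 0) =
    contract1 gi (\<lambda>j. \<Sum>p\<in>UNIV. \<Sum>q\<in>UNIV. ci p q * X p q j) N"
proof -
  have "contract2 ci gi X (\<lambda>m p j. if m = p then N j else 0) =
      (\<Sum>p\<in>UNIV. \<Sum>q\<in>UNIV. \<Sum>j\<in>UNIV. \<Sum>k\<in>UNIV. ci p q * gi j k * X p q j * cnj (N k))"
    unfolding contract2_def by (simp add: if_distrib cong: if_cong)
  also have "\<dots> = (\<Sum>p\<in>UNIV. \<Sum>j\<in>UNIV. \<Sum>k\<in>UNIV. \<Sum>q\<in>UNIV. ci p q * gi j k * X p q j * cnj (N k))"
    by (subst sum.swap, subst (3) sum.swap) (rule refl)
  also have "\<dots> = (\<Sum>j\<in>UNIV. \<Sum>k\<in>UNIV. \<Sum>p\<in>UNIV. \<Sum>q\<in>UNIV. ci p q * gi j k * X p q j * cnj (N k))"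
    by (subst sum.swap, subst (2) sum.swap) (rule refl)
  also have "\<dots> = contract1 gi (\<lambda>j. \<Sum>p\<in>UNIV. \<Sum>q\<in>UNIV. ci p q * X p q j) N"
    unfolding contract1_def sum_distrib_left sum_distrib_right by (simp add: ac_simps)
  finally show ?thesis .
qed

text \<open>This is the Cauchy--Schwarz inequality between \<open>E\<close> and the tensor \<open>F\<close> with the components
  \<open>g\<^bsub>s-bar p\<^esub> N\<^sub>j\<close>, since \<open>F\<close> has the square norm \<open>\<tau> |N|\<^sup>2\<close> and \<open>\<langle>E, F\<rangle> = |N|\<^sup>2\<close>.
  For \<open>\<tau> = 0\<close> the left-hand side is \<open>0\<close>.\<close>

lemma contract_cauchy_schwarz:
  fixes ci gi g :: "'n::finite \<Rightarrow> 'n \<Rightarrow> complex"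
  assumes herm: "\<forall>p q. cnj (ci p q) = ci q p" "\<forall>j k. cnj (gi j k) = gi k j"
      "\<forall>j k. cnj (g j k) = g k j"
    and pos: "\<forall>x. (\<exists>i. x i \<noteq> 0) \<longrightarrow> 0 < Re (contract1 ci x x)"
      "\<forall>x. (\<exists>i. x i \<noteq> 0) \<longrightarrow> 0 < Re (contract1 gi x x)"
    and inv: "\<forall>j k. (\<Sum>r\<in>UNIV. g j r * gi r k) = (if j = k then 1 else 0)"
    and \<tau>: "(\<Sum>p\<in>UNIV. \<Sum>q\<in>UNIV. ci p q * g q p) = complex_of_real \<tau>"
    and N: "\<And>j. N j = (\<Sum>p\<in>UNIV. \<Sum>q\<in>UNIV. ci p q * E p q j)"
  shows "Re (contract1 gi N N) / \<tau> \<le> Re (contract3 ci gi E E)"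
proof -
  define Y where "Y = (\<lambda>m (p :: 'n) j. if m = p then N j else 0)"
  define F where "F = lower g Y"
  have F: "F p s j = g s p * N j" for p s j
    by (simp add: F_def Y_def lower_def if_distrib cong: if_cong)
  define n where "n = contract1 gi N N"
  \<comment> \<open>For nonzero \<tau> this makes \<open>E + t F\<close> the remainder of
    \<open>E\<close> after subtracting its projection to \<open>F\<close>, up to the norm of
    \<open>N\<close> that cancels. For \<tau> = 0 division by zero gives \<open>t = 0\<close>, and
    the correction terms vanish.\<close>
  define t where "t = - complex_of_real (1 / \<tau>)"
  have EF: "contract3 ci gi E F = n"
    unfolding F_def contract3_lower[OF herm(3) inv] Y_def contract2_diagonal n_def by (simp only: N[symmetric])
  have FE: "contract3 ci gi F E = n"
    using contract3_cnj[OF herm(1,2), of E F] contract1_cnj[OF herm(2), of N N]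
    unfolding EF n_def by (simp only:)
  have "contract3 ci gi F F = contract3 ci gi F (lower g Y)"
    by (simp only: F_def)
  also have "\<dots> = contract1 gi (\<lambda>j. \<Sum>p\<in>UNIV. \<Sum>q\<in>UNIV. ci p q * F p q j) N"
    unfolding contract3_lower[OF herm(3) inv] Y_def contract2_diagonal ..
  also have "(\<lambda>j. \<Sum>p\<in>UNIV. \<Sum>q\<in>UNIV. ci p q * F p q j) = (\<lambda>j. complex_of_real \<tau> * N j)"
    unfolding \<tau>[symmetric] sum_distrib_right by (simp add: F ac_simps)
  also have "contract1 gi (\<lambda>j. complex_of_real \<tau> * N j) N = of_real \<tau> * n"
    by (simp add: n_def contract1_def sum_distrib_left ac_simps)
  finally have FF: "contract3 ci gi F F = of_real \<tau> * n" .
  have "0 \<le> Re (contract3 ci gi (\<lambda>p s j. E p s j + t * F p s j) (\<lambda>p s j. E p s j + t * F p s j))"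
    by (rule contract3_nonneg[OF herm(1,2) pos])
  also have "contract3 ci gi (\<lambda>p s j. E p s j + t * F p s j) (\<lambda>p s j. E p s j + t * F p s j) =
      contract3 ci gi E E + (cnj t * n + t * n + t * cnj t * of_real \<tau> * n)"
    unfolding contract3_add_left contract3_add_right contract3_scale_left contract3_scale_right
      EF FE FF by (simp add: algebra_simps)
  also have "cnj t * n + t * n + t * cnj t * of_real \<tau> * n = of_real (- 1 / \<tau>) * n"
    by (cases "\<tau> = 0") (simp_all add: t_def field_simps)
  finally show ?thesis by (simp add: n_def)
qed

text \<open>\<open>D\<close> stands for \<open>\<nabla>g\<close> and \<open>d\<close> for \<open>\<partial> Tr h\<close>; the condition \<open>\<partial>\<omega> = \<partial>\<chi>\<close> enters as \<open>exch\<close>.\<close>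

lemma pointwise_inequality:
  fixes ci gi c g :: "'n::finite \<Rightarrow> 'n \<Rightarrow> complex"
  assumes herm: "\<forall>p q. cnj (ci p q) = ci q p" "\<forall>j k. cnj (gi j k) = gi k j"
      "\<forall>j k. cnj (c j k) = c k j" "\<forall>j k. cnj (g j k) = g k j"
    and pos: "\<forall>x. (\<exists>i. x i \<noteq> 0) \<longrightarrow> 0 < Re (contract1 ci x x)"
      "\<forall>x. (\<exists>i. x i \<noteq> 0) \<longrightarrow> 0 < Re (contract1 gi x x)"
    and inv: "\<forall>j k. (\<Sum>r\<in>UNIV. ci j r * c r k) = (if j = k then 1 else 0)"
      "\<forall>j k. (\<Sum>r\<in>UNIV. g j r * gi r k) = (if j = k then 1 else 0)"
    and tr: "tr = (\<Sum>p\<in>UNIV. \<Sum>q\<in>UNIV. ci p q * g q p)"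
    and d: "\<And>j. d j = (\<Sum>p\<in>UNIV. \<Sum>q\<in>UNIV. ci p q * D j q p)"
    and dbar: "\<And>j. dbar j = cnj (d j)"
    and Dbar: "\<And>q k r. Dbar q k r = cnj (D q r k)"
    and T1: "\<And>j. T1 j = (\<Sum>p\<in>UNIV. T p p j)"
    and exch: "\<And>l k j. D l k j - D j k l = lower c T l k j - lower g T l k j"
  defines "lhs \<equiv> (\<Sum>j\<in>UNIV. \<Sum>k\<in>UNIV. gi j k * d j * dbar k) / tr
       - (\<Sum>p\<in>UNIV. \<Sum>q\<in>UNIV. \<Sum>j\<in>UNIV. \<Sum>k\<in>UNIV. \<Sum>r\<in>UNIV. \<Sum>s\<in>UNIV.
            ci p q * gi j k * gi r s * D p s j * Dbar q k r)
       - complex_of_real (Re (\<Sum>p\<in>UNIV. \<Sum>q\<in>UNIV. \<Sum>j\<in>UNIV. \<Sum>k\<in>UNIV. \<Sum>s\<in>UNIV.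
            ci p q * gi j k * D p s j * cnj (T s q k)))
       - complex_of_real (Re (\<Sum>p\<in>UNIV. \<Sum>q\<in>UNIV. \<Sum>j\<in>UNIV. \<Sum>k\<in>UNIV. \<Sum>r\<in>UNIV.
            ci p q * gi j k * Dbar k q r * T r p j))"
    and "rhs \<equiv> - 2 * complex_of_real (Re (\<Sum>j\<in>UNIV. \<Sum>k\<in>UNIV. gi j k * (d j / tr) * cnj (T1 k)))
       - (1 / tr) * (\<Sum>j\<in>UNIV. \<Sum>k\<in>UNIV. gi j k * T1 j * cnj (T1 k))
       + (\<Sum>p\<in>UNIV. \<Sum>q\<in>UNIV. \<Sum>j\<in>UNIV. \<Sum>k\<in>UNIV. \<Sum>r\<in>UNIV. \<Sum>s\<in>UNIV.
            ci p q * gi j k * c s r * T r p j * cnj (T s q k))"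
  shows "lhs \<in> \<real> \<and> rhs \<in> \<real> \<and> Re lhs \<le> Re rhs"
proof -
  let ?cT = "lower c T" and ?gT = "lower g T"
  \<comment> \<open>Hermitian symmetry makes the square norms and the trace real. The mixed terms
    \<open>dT\<close> and \<open>DT\<close> stay complex and enter only through their real
    parts.\<close>
  have real_if_cnj: "\<exists>r. z = complex_of_real r" if "cnj z = z" for z
    using that by (metis Reals_cases Reals_cnj_iff)
  have "cnj tr = tr"
    unfolding tr cnj_sum by (subst sum.swap) (simp add: herm)
  from real_if_cnj[OF this] obtain \<tau> where \<tau>: "tr = of_real \<tau>" by blast
  obtain dd where dd: "contract1 gi d d = of_real dd"
    using real_if_cnj[OF contract1_cnj[OF herm(2)]] by blast
  obtain TT where TT: "contract1 gi T1 T1 = of_real TT"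
    using real_if_cnj[OF contract1_cnj[OF herm(2)]] by blast
  obtain DD where DD: "contract3 ci gi D D = of_real DD"
    using real_if_cnj[OF contract3_cnj[OF herm(1,2)]] by blast
  obtain cTT where cTT: "contract2 ci gi ?cT T = of_real cTT"
    using real_if_cnj[OF contract2_lower_cnj[OF herm(1,2,3)]] by blast
  define dT where "dT = contract1 gi d T1"
  define DT where "DT = contract2 ci gi D T"
  define gTT where "gTT = contract2 ci gi ?gT T"

  have l1: "(\<Sum>j\<in>UNIV. \<Sum>k\<in>UNIV. gi j k * d j * dbar k) = of_real dd"
    unfolding dd[symmetric] contract1_def dbar ..
  have l2: "(\<Sum>p\<in>UNIV. \<Sum>q\<in>UNIV. \<Sum>j\<in>UNIV. \<Sum>k\<in>UNIV. \<Sum>r\<in>UNIV. \<Sum>s\<in>UNIV.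
      ci p q * gi j k * gi r s * D p s j * Dbar q k r) = of_real DD"
    unfolding DD[symmetric] contract3_def Dbar ..
  \<comment> \<open>In the fourth term the derivative index is contracted by \<open>gi\<close>
    instead of \<open>ci\<close>. The relation \<open>exch\<close> moves it to the place it has in
    \<open>DT\<close>, at the price of two torsion terms; one of them is the quadratic torsion term
    of the right-hand side.\<close>
  have "D k r q = D q r k - ?cT q r k + ?gT q r k" for k r q
    using exch[of q r k] by (simp add: algebra_simps)
  then have "Dbar k q r = cnj (D q r k - ?cT q r k + ?gT q r k)" for k q r
    unfolding Dbar by metis
  then have "(\<Sum>p\<in>UNIV. \<Sum>q\<in>UNIV. \<Sum>j\<in>UNIV. \<Sum>k\<in>UNIV. \<Sum>r\<in>UNIV. ci p q * gi j k * Dbar k q r * T r p j) =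
      cnj (contract2 ci gi (\<lambda>q r k. D q r k - ?cT q r k + ?gT q r k) T)"
    unfolding contract2_cnj[OF herm(1,2)] by (simp only:)
  also have "contract2 ci gi (\<lambda>q r k. D q r k - ?cT q r k + ?gT q r k) T = DT - of_real cTT + gTT"
    unfolding contract2_add_left contract2_diff_left cTT DT_def gTT_def ..
  finally have l4: "(\<Sum>p\<in>UNIV. \<Sum>q\<in>UNIV. \<Sum>j\<in>UNIV. \<Sum>k\<in>UNIV. \<Sum>r\<in>UNIV.
      ci p q * gi j k * Dbar k q r * T r p j) = cnj (DT - of_real cTT + gTT)" .
  have lhs: "lhs = of_real (dd / \<tau> - DD - Re DT - (Re DT - cTT + Re gTT))"
    unfolding lhs_def l1 l2 l4 \<tau> contract2_def[symmetric] DT_def[symmetric] by simp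

  have "(\<Sum>j\<in>UNIV. \<Sum>k\<in>UNIV. gi j k * (d j / tr) * cnj (T1 k)) = dT / of_real \<tau>"
    unfolding dT_def contract1_def \<tau> by (simp add: sum_divide_distrib)
  moreover have "(\<Sum>j\<in>UNIV. \<Sum>k\<in>UNIV. gi j k * T1 j * cnj (T1 k)) = of_real TT"
    unfolding TT[symmetric] contract1_def ..
  moreover have "(\<Sum>p\<in>UNIV. \<Sum>q\<in>UNIV. \<Sum>j\<in>UNIV. \<Sum>k\<in>UNIV. \<Sum>r\<in>UNIV. \<Sum>s\<in>UNIV.
      ci p q * gi j k * c s r * T r p j * cnj (T s q k)) = of_real cTT"
    unfolding cTT[symmetric] contract2_lower ..
  ultimately have rhs: "rhs = of_real (- 2 * (Re dT / \<tau>) - TT / \<tau> + cTT)"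
    unfolding rhs_def \<tau> by simp

  define E where "E = (\<lambda>p s j. D p s j + ?gT p s j)"
  \<comment> \<open>Through \<open>exch\<close> the torsion lowered by \<open>g\<close> is traded
    for the one lowered by \<open>c\<close>. In this form the trace is immediate: \<open>D\<close>
    contributes \<open>d\<close>, and the inverse \<open>ci\<close> of \<open>c\<close> turns
    \<open>?cT\<close> into \<open>T1\<close>.\<close>
  have E: "E p q j = D j q p + ?cT p q j" for p q j
    using exch[of p q j] by (simp add: E_def algebra_simps)
  have "(\<Sum>p\<in>UNIV. \<Sum>q\<in>UNIV. ci p q * ?cT p q j) = T1 j" for j
  proof -
    have "(\<Sum>q\<in>UNIV. ci p q * ?cT p q j) = (\<Sum>m\<in>UNIV. (\<Sum>q\<in>UNIV. ci p q * c q m) * T m p j)" for p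
      unfolding lower_def sum_distrib_left sum_distrib_right
      by (subst sum.swap) (simp add: ac_simps)
    then show ?thesis unfolding inv(1)[rule_format] T1 by (simp add: mult_delta_left)
  qed
  then have N: "d j + T1 j = (\<Sum>p\<in>UNIV. \<Sum>q\<in>UNIV. ci p q * E p q j)" for j
    unfolding E distrib_left sum.distrib d by simp
  have "Re (contract1 gi (\<lambda>j. d j + T1 j) (\<lambda>j. d j + T1 j)) / \<tau> \<le> Re (contract3 ci gi E E)"
    by (rule contract_cauchy_schwarz[OF herm(1,2,4) pos inv(2)]) (simp_all add: tr[symmetric] \<tau> N)
  moreover have "contract1 gi (\<lambda>j. d j + T1 j) (\<lambda>j. d j + T1 j) = of_real dd + (dT + cnj dT) + of_real TT"
    unfolding contract1_add_left contract1_add_right dd TT dT_def contract1_cnj[OF herm(2)] by simp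
  moreover have "contract3 ci gi E E = of_real DD + (DT + cnj DT) + gTT"
  proof -
    have "contract3 ci gi D ?gT = DT"
      unfolding DT_def by (rule contract3_lower[OF herm(4) inv(2)])
    moreover from this have "contract3 ci gi ?gT D = cnj DT"
      using contract3_cnj[OF herm(1,2)] by metis
    moreover have "contract3 ci gi ?gT ?gT = gTT"
      unfolding gTT_def by (rule contract3_lower[OF herm(4) inv(2)])
    ultimately show ?thesis
      unfolding E_def contract3_add_left contract3_add_right DD by simp
  qed
  \<comment> \<open>The two sides of this inequality differ by exactly
    \<open>Re rhs - Re lhs\<close>, since \<open>cTT\<close> occurs in both \<open>lhs\<close> and
    \<open>rhs\<close> and cancels.\<close>
  ultimately have "(dd + 2 * Re dT + TT) / \<tau> \<le> DD + 2 * Re DT + Re gTT"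
    by simp
  then show ?thesis
    unfolding lhs rhs by (simp add: add_divide_distrib)
qed

section \<open>Wirtinger derivatives and inverse matrices\<close>

lemma dz_eqI:
  assumes "(f has_derivative D) (at z)"
  shows "dz j f z = (D (axis j 1) - \<i> * D (axis j \<i>)) / 2"
  using frechet_derivative_at[OF assms] unfolding dz_def by simp

lemma dz_const: "dz j (\<lambda>w. a) z = 0"
  by (simp add: dz_def)

lemma dz_add:
  assumes "f differentiable (at z)" "g differentiable (at z)"
  shows "dz j (\<lambda>w. f w + g w) z = dz j f z + dz j g z"
  unfolding dz_def using assms by (simp add: frechet_derivative_add field_simps)

lemma dz_mult:
  assumes "f differentiable (at z)" "g differentiable (at z)"
  shows "dz j (\<lambda>w. f w * g w) z = dz j f z * g z + f z * dz j g z"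
proof -
  from assms have "(f has_derivative frechet_derivative f (at z)) (at z)"
    "(g has_derivative frechet_derivative g (at z)) (at z)"
    by (simp_all add: frechet_derivative_works[symmetric])
  from has_derivative_mult[OF this] show ?thesis
    by (subst dz_eqI, assumption) (simp add: dz_def[of j f] dz_def[of j g] field_simps)
qed

lemma dz_sum:
  assumes "finite I" "\<And>i. i \<in> I \<Longrightarrow> f i differentiable (at z)"
  shows "dz j (\<lambda>w. \<Sum>i\<in>I. f i w) z = (\<Sum>i\<in>I. dz j (f i) z)"
  using assms
proof (induction I rule: finite_induct)
  case (insert i I)
  then show ?case by (simp add: dz_add differentiable_sum)
qed (simp add: dz_const)

lemma dz_cong:
  assumes "f differentiable (at z)" "open S" "z \<in> S" "\<And>w. w \<in> S \<Longrightarrow> f w = g w"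
  shows "dz j f z = dz j g z"
  unfolding dz_def using frechet_derivative_transform_within_open[OF assms] by simp

text \<open>Conjugation exchanges the two Wirtinger operators. It is applied to the real function Tr
  h, with \<open>g = f\<close>, and to a pair of transposed entries of a Hermitian matrix
  field.\<close>

lemma dzbar_eq_cnj_dz:
  assumes "f differentiable (at z)" "open S" "z \<in> S" "\<And>w. w \<in> S \<Longrightarrow> f w = cnj (g w)"
  shows "dzbar k f z = cnj (dz k g z)"
proof -
  have cf: "(\<lambda>w. cnj (f w)) differentiable (at z)"
    using bounded_linear.has_derivative[OF bounded_linear_cnj] assms(1)
    unfolding differentiable_def by blast
  have "dz k g z = dz k (\<lambda>w. cnj (f w)) z"
    by (rule dz_cong[OF cf assms(2,3), symmetric]) (simp add: assms(4))
  also have "\<dots> = cnj (dzbar k f z)"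
    using frechet_derivative_linear[OF bounded_linear_cnj assms(1)] by (simp add: dz_def dzbar_def)
  finally show ?thesis by simp
qed

lemma C_k_on_dz:
  assumes "open S" "C_k_on (Suc k) S f"
  shows "C_k_on k S (dz j f)"
proof -
  have "dz j f = (\<lambda>w. (1/2) * frechet_derivative f (at w) (axis j 1)
      + (- \<i>/2) * frechet_derivative f (at w) (axis j \<i>))"
    by (simp add: dz_def fun_eq_iff field_simps)
  note eq = this
  show ?thesis
    unfolding eq using assms by (intro C_k_on_add C_k_on_linear[OF _ bounded_linear_mult_right]) simp_all
qed

lemma C_k_on_dzbar:
  assumes "open S" "C_k_on (Suc k) S f"
  shows "C_k_on k S (dzbar j f)"
proof -
  have "dzbar j f = (\<lambda>w. (1/2) * frechet_derivative f (at w) (axis j 1)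
      + (\<i>/2) * frechet_derivative f (at w) (axis j \<i>))"
    by (simp add: dzbar_def fun_eq_iff field_simps)
  note eq = this
  show ?thesis
    unfolding eq using assms by (intro C_k_on_add C_k_on_linear[OF _ bounded_linear_mult_right]) simp_all
qed

text \<open>Each side expands into the same four real second derivatives along
  \<open>axis l 1\<close>, \<open>axis l \<i>\<close> and \<open>axis j 1\<close>,
  \<open>axis j \<i>\<close>, up to the order of differentiation.\<close>

lemma dz_commute:
  assumes C: "C_k_on 2 S f" and S: "open S" "z \<in> S"
  shows "dz l (dz j f) z = dz j (dz l f) z"
proof -
  let ?D = "\<lambda>u v. frechet_derivative (\<lambda>w. frechet_derivative f (at w) u) (at z) v"
  have d: "(\<lambda>w. frechet_derivative f (at w) u) differentiable (at z)" for u
    using C S by (auto simp: numeral_2_eq_2)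
  have dc: "(\<lambda>w. a * frechet_derivative f (at w) u) differentiable (at z)" for a u
    using d by (simp add: differentiable_mult)
  have eq: "dz j f = (\<lambda>w. (1/2) * frechet_derivative f (at w) (axis j 1)
      + (- \<i>/2) * frechet_derivative f (at w) (axis j \<i>))" for j
    by (simp add: dz_def fun_eq_iff field_simps)
  have D: "frechet_derivative (dz j f) (at z) v = (1/2) * ?D (axis j 1) v + (- \<i>/2) * ?D (axis j \<i>) v" for j v
    unfolding eq frechet_derivative_add[OF dc dc]
      frechet_derivative_linear[OF bounded_linear_mult_right d] ..
  note sym = mixed_derivatives_commute[OF C S]
  show ?thesis
    unfolding dz_def[of _ "dz _ f"] D sym[of "axis l 1" "axis j 1"] sym[of "axis l 1" "axis j \<i>"]
      sym[of "axis l \<i>" "axis j 1"] sym[of "axis l \<i>" "axis j \<i>"]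
    by (simp add: algebra_simps)
qed

section \<open>Inverse matrices: differentiability, symmetry and positivity\<close>

lemma differentiable_prod:
  fixes f :: "'i \<Rightarrow> 'a::real_normed_vector \<Rightarrow> 'b::real_normed_field"
  assumes "finite I" "\<And>i. i \<in> I \<Longrightarrow> f i differentiable (at z)"
  shows "(\<lambda>w. \<Prod>i\<in>I. f i w) differentiable (at z)"
  using assms by (induction I rule: finite_induct) (simp_all add: differentiable_mult)

lemma differentiable_det:
  fixes A :: "'a::real_normed_vector \<Rightarrow> complex^'n^'n"
  assumes "\<And>i j. (\<lambda>w. A w $ i $ j) differentiable (at z)"
  shows "(\<lambda>w. det (A w)) differentiable (at z)"
proof -
  have "(\<lambda>w. of_int (sign p) * (\<Prod>i\<in>UNIV. A w $ i $ p i)) differentiable (at z)" for p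
    by (rule differentiable_mult[OF differentiable_const], rule differentiable_prod) (simp_all add: assms)
  then show ?thesis unfolding det_def by (intro differentiable_sum) auto
qed

lemma matrix_inv_inverse:
  fixes A :: "complex^'n^'n"
  assumes "invertible A"
  shows "A ** matrix_inv A = mat 1" "matrix_inv A ** A = mat 1"
  using someI_ex[OF assms[unfolded invertible_def]] by (simp_all add: matrix_inv_def)

text \<open>The column \<open>r\<close> of the inverse solves \<open>A *v x = axis r 1\<close>.
  Cramer's rule presents its entries as quotients of polynomials in the entries of \<open>A\<close>,
  from which differentiability follows.\<close>

lemma matrix_inv_cramer:
  fixes A :: "complex^'n^'n"
  assumes "invertible A"
  shows "matrix_inv A $ p $ r = det (\<chi> i j. if j = p then axis r 1 $ i else A $ i $ j) / det A"
proof -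
  have "A *v (matrix_inv A *v axis r 1) = axis r 1"
    by (simp add: matrix_vector_mul_assoc matrix_inv_inverse[OF assms])
  then have "matrix_inv A *v axis r 1 = (\<chi> k. det (\<chi> i j. if j = k then axis r 1 $ i else A $ i $ j) / det A)"
    using assms by (subst (asm) cramer) (simp_all add: invertible_det_nz[symmetric])
  moreover have "(matrix_inv A *v axis r 1) $ p = matrix_inv A $ p $ r"
    by (simp add: matrix_vector_mult_def axis_def if_distrib cong: if_cong)
  ultimately show ?thesis by simp
qed

lemma differentiable_matrix_inv:
  fixes A :: "'a::real_normed_vector \<Rightarrow> complex^'n^'n"
  assumes d: "\<And>i j. (\<lambda>w. A w $ i $ j) differentiable (at z)"
    and S: "open S" "z \<in> S" and inv: "\<And>w. w \<in> S \<Longrightarrow> invertible (A w)"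
  shows "(\<lambda>w. matrix_inv (A w) $ p $ r) differentiable (at z)"
proof -
  let ?B = "\<lambda>w. \<chi> i j. if j = p then axis r 1 $ i else A w $ i $ j"
  have "(\<lambda>w. ?B w $ i $ j) differentiable (at z)" for i j
    using d by (cases "j = p") simp_all
  then have "(\<lambda>w. det (?B w) / det (A w)) differentiable (at z)"
    using inv[OF S(2)] d
    by (intro differentiable_divide differentiable_det) (simp_all add: invertible_det_nz)
  then obtain D where "((\<lambda>w. det (?B w) / det (A w)) has_derivative D) (at z)"
    unfolding differentiable_def by blast
  then have "((\<lambda>w. matrix_inv (A w) $ p $ r) has_derivative D) (at z)"
    by (rule has_derivative_transform_within_open[OF _ S]) (simp add: matrix_inv_cramer inv)
  then show ?thesis unfolding differentiable_def by blast
qed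

lemma sesq_matrix_vector: "sesq B V V = (\<Sum>k\<in>UNIV. (B *v V) $ k * cnj (V $ k))"
  unfolding sesq_def matrix_vector_mult_def by (simp add: sum_distrib_right)

lemma pos_def_hermitian_invertible:
  assumes "pos_def_hermitian B"
  shows "invertible B"
proof -
  have "V = 0" if "B *v V = 0" for V
  proof (rule ccontr)
    assume "V \<noteq> 0"
    then have "0 < Re (sesq B V V)" using assms by (simp add: pos_def_hermitian_def)
    then show False by (simp add: sesq_matrix_vector that)
  qed
  then show ?thesis
    using matrix_left_invertible_ker invertible_left_inverse by blast
qed

lemma matrix_inverse_sums:
  fixes A B :: "complex^'n^'n"
  assumes "A ** B = mat 1"
  shows "(\<Sum>r\<in>UNIV. A $ j $ r * B $ r $ k) = (if j = k then 1 else 0)"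
  using arg_cong[OF assms, of "\<lambda>M. M $ j $ k"] by (simp add: matrix_matrix_mult_def mat_def)

text \<open>The conjugate transpose of the inverse is also a left inverse of \<open>B\<close>, and
  inverses are unique.\<close>

lemma matrix_inv_hermitian:
  assumes "pos_def_hermitian B"
  shows "cnj (matrix_inv B $ p $ q) = matrix_inv B $ q $ p"
proof -
  define C where "C = (\<chi> i j. cnj (matrix_inv B $ j $ i))"
  note inv = matrix_inv_inverse[OF pos_def_hermitian_invertible[OF assms]]
  have "C ** B = mat 1"
  proof -
    have "(C ** B) $ j $ k = cnj (\<Sum>r\<in>UNIV. B $ k $ r * matrix_inv B $ r $ j)" for j k
    proof -
      have "cnj (B $ k $ r) = B $ r $ k" for r
        using assms by (metis pos_def_hermitian_def)
      then show ?thesis by (simp add: C_def matrix_matrix_mult_def mult.commute)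
    qed
    then show ?thesis
      unfolding matrix_inverse_sums[OF inv(1)] by (simp add: vec_eq_iff mat_def)
  qed
  then have "C = matrix_inv B"
    by (metis inv(1) matrix_mul_assoc matrix_mul_lid matrix_mul_rid)
  then have "C $ q $ p = matrix_inv B $ q $ p" by simp
  then show ?thesis by (simp add: C_def)
qed

text \<open>With \<open>V\<close> the image of the conjugate of \<open>x\<close> under the inverse,
  the form of the inverse at \<open>x\<close> is the conjugate of the form of \<open>B\<close> at
  \<open>V\<close>.\<close>

lemma matrix_inv_pos_def:
  assumes "pos_def_hermitian B" "\<exists>i. x i \<noteq> 0"
  shows "0 < Re (contract1 (\<lambda>j k. matrix_inv B $ j $ k) x x)"
proof -
  define y where "y = (\<chi> k. cnj (x k))"
  define V where "V = matrix_inv B *v y"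
  have BV: "B *v V = y"
    by (simp add: V_def matrix_vector_mul_assoc
        matrix_inv_inverse[OF pos_def_hermitian_invertible[OF assms(1)]])
  have "y \<noteq> 0" using assms(2) by (auto simp: y_def vec_eq_iff)
  then have "V \<noteq> 0" using BV by auto
  then have "0 < Re (sesq B V V)" using assms(1) by (simp add: pos_def_hermitian_def)
  also have "sesq B V V = cnj (\<Sum>k\<in>UNIV. x k * V $ k)"
    by (simp add: sesq_matrix_vector BV y_def)
  also have "(\<Sum>k\<in>UNIV. x k * V $ k) = contract1 (\<lambda>j k. matrix_inv B $ j $ k) x x"
    by (simp add: V_def y_def contract1_def matrix_vector_mult_def sum_distrib_left ac_simps)
  finally show ?thesis by simp
qed

section \<open>The trace inequality\<close>

lemma hermitian_metric_differentiable:
  assumes "hermitian_metric A \<eta>" "(U, \<phi>) \<in> A" "z \<in> \<phi> ` U"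
  shows "(\<lambda>w. \<eta> (U, \<phi>) w $ k $ j) differentiable (at z)"
proof -
  have "smooth_on (\<phi> ` U) (\<eta> (U, \<phi>))"
    using assms(1,2) unfolding hermitian_metric_def by fast
  then have "C_k_on (Suc 0) (\<phi> ` U) (\<eta> (U, \<phi>))"
    by (simp only: smooth_on_def)
  then have "\<eta> (U, \<phi>) differentiable (at z)"
    using assms(3) by auto
  then obtain D where "(\<eta> (U, \<phi>) has_derivative D) (at z)"
    unfolding differentiable_def by blast
  then have "((\<lambda>w. \<eta> (U, \<phi>) w $ k $ j) has_derivative (\<lambda>v. D v $ k $ j)) (at z)"
    by (intro bounded_linear.has_derivative[OF bounded_linear_vec_nth])
  then show ?thesis
    unfolding differentiable_def by blast
qed

lemma hermitian_metric_pos_def: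
  assumes "hermitian_metric A \<eta>" "(U, \<phi>) \<in> A" "z \<in> \<phi> ` U"
  shows "pos_def_hermitian (\<eta> (U, \<phi>) z)"
  using assms unfolding hermitian_metric_def by fast

text \<open>With \<open>G\<close> the derivative of \<open>u\<close> by \<open>dzbar k\<close>, the
  components in row \<open>k\<close> differ by \<open>dz j G\<close>. So the coefficients of the two
  forms differ by a multiple of \<open>dz l (dz j G) z - dz j (dz l G) z\<close>.\<close>

lemma same_del_if_diff_ddbar_exact:
  assumes X: "complex_manifold X A" and chi: "hermitian_metric A chi"
    and ex: "diff_ddbar_exact A \<omega> chi"
  shows "same_del A \<omega> chi"
proof -
  obtain u :: "'a \<Rightarrow> real" where u: "\<And>U \<phi>. (U, \<phi>) \<in> A \<Longrightarrow> smooth_on (\<phi> ` U) (u \<circ> inv_into U \<phi>)"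
    and eq: "\<And>U \<phi> z k j. (U, \<phi>) \<in> A \<Longrightarrow> z \<in> \<phi> ` U \<Longrightarrow>
      \<omega> (U, \<phi>) z $ k $ j - chi (U, \<phi>) z $ k $ j =
        dz j (dzbar k (\<lambda>w. complex_of_real (u (inv_into U \<phi> w)))) z"
    using ex unfolding diff_ddbar_exact_def by fast
  have "del_coeff (\<omega> (U, \<phi>)) z l j k = del_coeff (chi (U, \<phi>)) z l j k"
    if chart: "(U, \<phi>) \<in> A" and z: "z \<in> \<phi> ` U" for U \<phi> z l j k
  proof -
    let ?S = "\<phi> ` U"
    define G where "G = dzbar k (\<lambda>w. complex_of_real (u (inv_into U \<phi> w)))"
    have S: "open ?S" using X chart unfolding complex_manifold_def by fast
    \<comment> \<open>Three orders: one is spent on \<open>dzbar k\<close>, and the symmetry of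
      second derivatives of \<open>G\<close> takes the other two.\<close>
    have "C_k_on 3 ?S (\<lambda>w. complex_of_real ((u \<circ> inv_into U \<phi>) w))"
      using u[OF chart] unfolding smooth_on_def by (intro C_k_on_linear[OF S bounded_linear_of_real]) blast
    then have "C_k_on (Suc 2) ?S (\<lambda>w. complex_of_real (u (inv_into U \<phi> w)))"
      by (simp only: o_apply eval_nat_numeral)
    then have G: "C_k_on 2 ?S G"
      unfolding G_def by (rule C_k_on_dzbar[OF S])
    then have "C_k_on 1 ?S (dz i G)" for i
      by (intro C_k_on_dz[OF S]) (simp only: numeral_2_eq_2 One_nat_def)
    then have dG: "dz i G differentiable (at z)" for i
      using z by auto
    note dchi = hermitian_metric_differentiable[OF chi chart z, where k = k]
    have "dz m (\<lambda>w. \<omega> (U, \<phi>) w $ k $ i) z = dz m (\<lambda>w. chi (U, \<phi>) w $ k $ i) z + dz m (dz i G) z" for m i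
    proof -
      \<comment> \<open>The entries of \<omega> agree with \<open>chi + dz i G\<close> on the whole
        open coordinate domain, so their derivatives can be read off from this sum.\<close>
      have "dz m (\<lambda>w. chi (U, \<phi>) w $ k $ i + dz i G w) z = dz m (\<lambda>w. \<omega> (U, \<phi>) w $ k $ i) z"
        by (rule dz_cong[OF differentiable_add[OF dchi dG] S z])
          (simp add: G_def eq[OF chart, symmetric])
      then show ?thesis by (simp add: dz_add[OF dchi dG])
    qed
    then show ?thesis
      unfolding del_coeff_def using dz_commute[OF G S z, of l j] by simp
  qed
  then show ?thesis unfolding same_del_def by auto
qed

section \<open>Derivative of the trace and the lowered torsion\<close>

lemma dz_matrix_inv:
  assumes d: "\<And>i j. (\<lambda>w. c w $ i $ j) differentiable (at z)"
    and S: "open S" "z \<in> S" and inv: "\<And>w. w \<in> S \<Longrightarrow> invertible (c w)"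
  shows "dz j (\<lambda>w. matrix_inv (c w) $ p $ s) z =
    - (\<Sum>q\<in>UNIV. chern_Gamma c z p j q * matrix_inv (c z) $ q $ s)"
proof -
  let ?I = "\<lambda>w p r. matrix_inv (c w) $ p $ r"
  have dI: "(\<lambda>w. ?I w p r) differentiable (at z)" for p r
    by (rule differentiable_matrix_inv[OF d S inv])
  have "(\<Sum>r\<in>UNIV. dz j (\<lambda>w. ?I w p r) z * c z $ r $ q) = - chern_Gamma c z p j q" for q
  proof -
    have dp: "(\<lambda>w. ?I w p r * c w $ r $ q) differentiable (at z)" for r
      using dI d by (rule differentiable_mult)
    \<comment> \<open>The product of the inverse with \<open>c\<close> is constantly the identity
      near \<open>z\<close>. Differentiating it produces the Christoffel symbol, and multiplying by
      the inverse from the right then isolates the derivative sought.\<close>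
    have "dz j (\<lambda>w. \<Sum>r\<in>UNIV. ?I w p r * c w $ r $ q) z = dz j (\<lambda>w. if p = q then 1 else 0) z"
      using dp by (intro dz_cong[OF _ S] differentiable_sum)
        (simp_all add: matrix_inverse_sums[OF matrix_inv_inverse(2)] inv)
    then have "0 = dz j (\<lambda>w. \<Sum>r\<in>UNIV. ?I w p r * c w $ r $ q) z"
      by (simp only: dz_const)
    also have "\<dots> = (\<Sum>r\<in>UNIV. dz j (\<lambda>w. ?I w p r) z * c z $ r $ q) + chern_Gamma c z p j q"
      by (simp add: dz_sum[OF _ dp] dz_mult[OF dI d] sum.distrib chern_Gamma_def)
    finally show ?thesis by (simp add: eq_neg_iff_add_eq_0)
  qed
  then have "- (\<Sum>q\<in>UNIV. chern_Gamma c z p j q * ?I z q s) =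
      (\<Sum>q\<in>UNIV. (\<Sum>r\<in>UNIV. dz j (\<lambda>w. ?I w p r) z * c z $ r $ q) * ?I z q s)"
    by (simp add: sum_negf)
  also have "\<dots> = (\<Sum>r\<in>UNIV. dz j (\<lambda>w. ?I w p r) z * (\<Sum>q\<in>UNIV. c z $ r $ q * ?I z q s))"
    unfolding sum_distrib_left sum_distrib_right by (subst sum.swap) (simp add: mult.assoc)
  also have "\<dots> = dz j (\<lambda>w. ?I w p s) z"
    unfolding matrix_inverse_sums[OF matrix_inv_inverse(1)[OF inv[OF S(2)]]]
    by (simp add: if_distrib cong: if_cong)
  finally show ?thesis ..
qed

lemma trace_endo_h:
  "trace (endo_h c g w) = (\<Sum>p\<in>UNIV. \<Sum>q\<in>UNIV. matrix_inv (c w) $ p $ q * g w $ q $ p)"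
  by (simp add: trace_def endo_h_def matrix_matrix_mult_def)

text \<open>The inverse metric is parallel for its Chern connection: the \<Gamma> terms from
  differentiating it are exactly those that complete the partial derivative of g to
  \<nabla>g.\<close>

lemma dz_trace_endo_h:
  assumes dc: "\<And>i j. (\<lambda>w. c w $ i $ j) differentiable (at z)"
    and dg: "\<And>i j. (\<lambda>w. g w $ i $ j) differentiable (at z)"
    and S: "open S" "z \<in> S" and inv: "\<And>w. w \<in> S \<Longrightarrow> invertible (c w)"
  shows "(\<lambda>w. trace (endo_h c g w)) differentiable (at z)"
    and "dz j (\<lambda>w. trace (endo_h c g w)) z =
      (\<Sum>p\<in>UNIV. \<Sum>q\<in>UNIV. matrix_inv (c z) $ p $ q * nabla_sesq c g z j q p)"
proof -
  let ?I = "\<lambda>w p r. matrix_inv (c w) $ p $ r"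
  have dI: "(\<lambda>w. ?I w p r) differentiable (at z)" for p r
    by (rule differentiable_matrix_inv[OF dc S inv])
  have dp: "(\<lambda>w. ?I w p q * g w $ q $ p) differentiable (at z)" for p q
    using dI dg by (rule differentiable_mult)
  then have ds: "(\<lambda>w. \<Sum>q\<in>UNIV. ?I w p q * g w $ q $ p) differentiable (at z)" for p
    by (intro differentiable_sum) auto
  then show "(\<lambda>w. trace (endo_h c g w)) differentiable (at z)"
    unfolding trace_endo_h by (intro differentiable_sum) auto
  have "dz j (\<lambda>w. trace (endo_h c g w)) z =
      (\<Sum>p\<in>UNIV. \<Sum>q\<in>UNIV. ?I z p q * dz j (\<lambda>w. g w $ q $ p) z)
      - (\<Sum>p\<in>UNIV. \<Sum>q\<in>UNIV. \<Sum>m\<in>UNIV. chern_Gamma c z p j m * ?I z m q * g z $ q $ p)"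
    unfolding trace_endo_h
    by (simp add: dz_sum[OF _ ds] dz_sum[OF _ dp] dz_mult[OF dI dg] dz_matrix_inv[OF dc S inv]
        sum.distrib sum_subtractf sum_negf sum_distrib_right)
  \<comment> \<open>The sum over the upper index of \<Gamma> is moved innermost, where it is the
    correction term in \<open>nabla_sesq_eq\<close>.\<close>
  also have "(\<Sum>p\<in>UNIV. \<Sum>q\<in>UNIV. \<Sum>m\<in>UNIV. chern_Gamma c z p j m * ?I z m q * g z $ q $ p) =
      (\<Sum>p\<in>UNIV. \<Sum>m\<in>UNIV. \<Sum>q\<in>UNIV. chern_Gamma c z p j m * ?I z m q * g z $ q $ p)"
    by (intro sum.cong refl sum.swap)
  also have "\<dots> = (\<Sum>m\<in>UNIV. \<Sum>q\<in>UNIV. \<Sum>p\<in>UNIV. chern_Gamma c z p j m * ?I z m q * g z $ q $ p)"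
    by (subst sum.swap, intro sum.cong refl sum.swap)
  finally show "dz j (\<lambda>w. trace (endo_h c g w)) z =
      (\<Sum>p\<in>UNIV. \<Sum>q\<in>UNIV. ?I z p q * nabla_sesq c g z j q p)"
    by (simp add: nabla_sesq_eq right_diff_distrib sum_subtractf sum_distrib_left ac_simps)
qed

text \<open>Lowering \<Gamma> with \<open>c\<close> cancels the inverse in its definition. The
  torsion is therefore the coefficient \<open>del_coeff c\<close> without its factor
  \<open>\<i>\<close>, with one index raised.\<close>

lemma lower_torsion:
  assumes "invertible (c z)"
  shows "lower (\<lambda>k m. c z $ k $ m) (torsion c z) l k j =
    dz l (\<lambda>w. c w $ k $ j) z - dz j (\<lambda>w. c w $ k $ l) z"
proof -
  have "(\<Sum>m\<in>UNIV. c z $ k $ m * chern_Gamma c z m l j) = dz l (\<lambda>w. c w $ k $ j) z" for l j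
  proof -
    have "(\<Sum>m\<in>UNIV. c z $ k $ m * chern_Gamma c z m l j) =
        (\<Sum>r\<in>UNIV. (\<Sum>m\<in>UNIV. c z $ k $ m * matrix_inv (c z) $ m $ r) * dz l (\<lambda>w. c w $ r $ j) z)"
      unfolding chern_Gamma_def sum_distrib_left sum_distrib_right
      by (subst sum.swap) (simp add: mult.assoc)
    then show ?thesis
      unfolding matrix_inverse_sums[OF matrix_inv_inverse(1)[OF assms]]
      by (simp add: if_distribR if_distrib[of "\<lambda>x. x * _"] cong: if_cong)
  qed
  then show ?thesis
    unfolding lower_def torsion_def by (simp add: right_diff_distrib sum_subtractf)
qed

theorem corollary1:
  fixes X :: "'a topology"
    and A :: "('a, 'n::finite) chart set"
    and chi \<omega> :: "('a, 'n) form11"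
  assumes "complex_manifold X A"
    and "compact_space X"
    and "hermitian_metric A chi"
    and "hermitian_metric A \<omega>"
  shows
    "(diff_ddbar_exact A \<omega> chi \<longrightarrow> same_del A \<omega> chi) \<and>
     (same_del A \<omega> chi \<longrightarrow>
       (\<forall>(U, \<phi>)\<in>A. \<forall>x\<in>U.
         let z = \<phi> x;
             c = chi (U, \<phi>);
             g = \<omega> (U, \<phi>);
             ci = matrix_inv (c z);
             gi = matrix_inv (g z);
             Trh = (\<lambda>w. trace (endo_h c g w));
             T = torsion c z;
             T1 = torsion_1form c z;
             D = nabla_sesq c g z;
             Dbar = nablabar_sesq c g z;
             lhs =
               (\<Sum>j\<in>UNIV. \<Sum>k\<in>UNIV. gi $ j $ k * dz j Trh z * dzbar k Trh z) / Trh z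
               - (\<Sum>p\<in>UNIV. \<Sum>q\<in>UNIV. \<Sum>j\<in>UNIV. \<Sum>k\<in>UNIV. \<Sum>r\<in>UNIV. \<Sum>s\<in>UNIV.
                    ci $ p $ q * gi $ j $ k * gi $ r $ s * D p s j * Dbar q k r)
               - complex_of_real (Re (\<Sum>p\<in>UNIV. \<Sum>q\<in>UNIV. \<Sum>j\<in>UNIV. \<Sum>k\<in>UNIV. \<Sum>s\<in>UNIV.
                    ci $ p $ q * gi $ j $ k * D p s j * cnj (T s q k)))
               - complex_of_real (Re (\<Sum>p\<in>UNIV. \<Sum>q\<in>UNIV. \<Sum>j\<in>UNIV. \<Sum>k\<in>UNIV. \<Sum>r\<in>UNIV.
                    ci $ p $ q * gi $ j $ k * Dbar k q r * T r p j));
             rhs =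
               - 2 * complex_of_real (Re (\<Sum>j\<in>UNIV. \<Sum>k\<in>UNIV.
                    gi $ j $ k * (dz j Trh z / Trh z) * cnj (T1 k)))
               - (1 / Trh z) * (\<Sum>j\<in>UNIV. \<Sum>k\<in>UNIV. gi $ j $ k * T1 j * cnj (T1 k))
               + (\<Sum>p\<in>UNIV. \<Sum>q\<in>UNIV. \<Sum>j\<in>UNIV. \<Sum>k\<in>UNIV. \<Sum>r\<in>UNIV. \<Sum>s\<in>UNIV.
                    ci $ p $ q * gi $ j $ k * c z $ s $ r * T r p j * cnj (T s q k))
         in lhs \<in> \<real> \<and> rhs \<in> \<real> \<and> Re lhs \<le> Re rhs))"
proof (intro conjI impI ballI, goal_cases)
  case 1
  then show ?case using same_del_if_diff_ddbar_exact[OF assms(1,3)] by blast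
next
  case (2 a)
  obtain U \<phi> where a: "a = (U, \<phi>)" by (cases a)
  have chart: "(U, \<phi>) \<in> A" using 2 a by simp
  show ?case unfolding a prod.case
  proof (rule ballI, goal_cases)
    case (1 x)
    then have "x \<in> U" .
    define z where "z = \<phi> x"
    define c where "c = chi (U, \<phi>)"
    define g where "g = \<omega> (U, \<phi>)"
    let ?S = "\<phi> ` U"
    have S: "open ?S" using assms(1) chart unfolding complex_manifold_def by fast
    have z: "z \<in> ?S" using \<open>x \<in> U\<close> by (simp add: z_def)
    note pos_c = hermitian_metric_pos_def[OF assms(3) chart, folded c_def]
    note pos_g = hermitian_metric_pos_def[OF assms(4) chart, folded g_def]
    note dc = hermitian_metric_differentiable[OF assms(3) chart z, folded c_def]
    note dg = hermitian_metric_differentiable[OF assms(4) chart z, folded g_def]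
    note inv_c = pos_def_hermitian_invertible[OF pos_c]
    note inv_g = pos_def_hermitian_invertible[OF pos_g]
    note dtr = dz_trace_endo_h[OF dc dg S z inv_c]
    have herm_c: "cnj (c w $ j $ k) = c w $ k $ j" and herm_g: "cnj (g w $ j $ k) = g w $ k $ j"
      if "w \<in> ?S" for w j k
      using pos_c[OF that] pos_g[OF that] by (metis pos_def_hermitian_def)+
    \<comment> \<open>Conjugation transposes both Hermitian factors, so it only exchanges the
      summation indices \<open>p\<close> and \<open>q\<close>.\<close>
    have tr_real: "trace (endo_h c g w) = cnj (trace (endo_h c g w))" if "w \<in> ?S" for w
      unfolding trace_endo_h cnj_sum complex_cnj_mult matrix_inv_hermitian[OF pos_c[OF that]] herm_g[OF that]
      by (rule sum.swap)
    \<comment> \<open>The equality of the two forms replaces the antisymmetrised derivative of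
      \<open>g\<close> by that of \<open>c\<close>, which is the torsion lowered by
      \<open>c\<close>; the \<Gamma> terms of the two covariant derivatives combine to the torsion
      lowered by \<open>g\<close>.\<close>
    have exch: "nabla_sesq c g z l k j - nabla_sesq c g z j k l =
        lower (\<lambda>k m. c z $ k $ m) (torsion c z) l k j - lower (\<lambda>k m. g z $ k $ m) (torsion c z) l k j"
      for l k j
    proof -
      have "del_coeff g z l j k = del_coeff c z l j k"
        using 2(1) chart z unfolding same_del_def g_def c_def by fast
      then have "dz l (\<lambda>w. g w $ k $ j) z - dz j (\<lambda>w. g w $ k $ l) z =
          dz l (\<lambda>w. c w $ k $ j) z - dz j (\<lambda>w. c w $ k $ l) z"
        by (simp add: del_coeff_def)
      then show ?thesis
        unfolding lower_torsion[where c=c and z=z, OF inv_c[OF z]]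
        by (simp add: nabla_sesq_eq lower_def torsion_def left_diff_distrib
            right_diff_distrib sum_subtractf mult.commute)
    qed
    have Dbar: "nablabar_sesq c g z q k r = cnj (nabla_sesq c g z q r k)" for q k r
    proof -
      have "dzbar q (\<lambda>w. g w $ k $ r) z = cnj (dz q (\<lambda>w. g w $ r $ k) z)"
        by (rule dzbar_eq_cnj_dz[OF dg S z]) (simp add: herm_g)
      then show ?thesis
        by (simp add: nablabar_sesq_eq nabla_sesq_eq herm_g[OF z])
    qed
    have ci_herm: "\<forall>p q. cnj (matrix_inv (c z) $ p $ q) = matrix_inv (c z) $ q $ p"
      using matrix_inv_hermitian[OF pos_c[OF z]] by blast
    have gi_herm: "\<forall>p q. cnj (matrix_inv (g z) $ p $ q) = matrix_inv (g z) $ q $ p"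
      using matrix_inv_hermitian[OF pos_g[OF z]] by blast
    have c_herm: "\<forall>j k. cnj (c z $ j $ k) = c z $ k $ j" using herm_c[OF z] by blast
    have g_herm: "\<forall>j k. cnj (g z $ j $ k) = g z $ k $ j" using herm_g[OF z] by blast
    have ci_pos: "\<forall>x. (\<exists>i. x i \<noteq> 0) \<longrightarrow> 0 < Re (contract1 (\<lambda>p q. matrix_inv (c z) $ p $ q) x x)"
      using matrix_inv_pos_def[OF pos_c[OF z]] by blast
    have gi_pos: "\<forall>x. (\<exists>i. x i \<noteq> 0) \<longrightarrow> 0 < Re (contract1 (\<lambda>p q. matrix_inv (g z) $ p $ q) x x)"
      using matrix_inv_pos_def[OF pos_g[OF z]] by blast
    have ci_c: "\<forall>j k. (\<Sum>r\<in>UNIV. matrix_inv (c z) $ j $ r * c z $ r $ k) = (if j = k then 1 else 0)"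
      using matrix_inverse_sums[OF matrix_inv_inverse(2)[OF inv_c[OF z]]] by blast
    have g_gi: "\<forall>j k. (\<Sum>r\<in>UNIV. g z $ j $ r * matrix_inv (g z) $ r $ k) = (if j = k then 1 else 0)"
      using matrix_inverse_sums[OF matrix_inv_inverse(1)[OF inv_g[OF z]]] by blast
    have dbar: "dzbar k (\<lambda>w. trace (endo_h c g w)) z = cnj (dz k (\<lambda>w. trace (endo_h c g w)) z)" for k
      by (rule dzbar_eq_cnj_dz[OF dtr(1) S z tr_real])
    show ?case
      unfolding Let_def z_def[symmetric] c_def[symmetric] g_def[symmetric]
      by (rule pointwise_inequality[of "\<lambda>p q. matrix_inv (c z) $ p $ q" "\<lambda>p q. matrix_inv (g z) $ p $ q"
            "\<lambda>p q. c z $ p $ q" "\<lambda>p q. g z $ p $ q"])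
        (fact ci_herm gi_herm c_herm g_herm ci_pos gi_pos ci_c g_gi trace_endo_h
          | rule dtr(2) dbar Dbar torsion_1form_def exch | assumption)+
  qed
qed

end
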